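(* Let weak pairs $(A,\omega_A)$ and $(B,\omega_B)$ be mirror symmetric, with a mirror symmetry given by $\alpha:\Lambda_A\to\Lambda_B$, and let $n=\dim A=\dim B$. Let $\beta:H^*(A,\mathbb Z)\to H^*(B,\mathbb Z)$ be the associated isomorphism (unique up to sign) of Clifford modules. Then the parity of $\beta$ is equal to the parity of $n$.
   Context: A complex torus is $A=(V/\Gamma,J)$ with $\Gamma=\Gamma_A=H_1(A,\mathbb Z)$ a lattice of rank $2\dim A$, $V=V_A=\Gamma\otimes\mathbb R$, and $J=J_A\in\mathrm{End}(V)$, $J^2=-1$. The dual torus is $\hat A=(V^*/\Gamma^*,\hat J)$, $(\hat Jw)(v)=w(-Jv)$. The Néron–Severi group $NS_A$ is identified (by first Chern class) with the group of integral skew-symmetric forms $c$ on $\Gamma$ with $c_{\mathbb R}$ $J$-invariant, and with a subgroup of $\mathrm{Hom}(A,\hat A)$ via $c\mapsto(v\mapsto c(v,\cdot))$. $NS_A(\mathbb R)=NS_A\otimes\mathbb R$, $NS_A(\mathbb C)=NS_A\otimes\mathbb C$, $NS_A(\mathbb R)^0\subset NS_A(\mathbb R)$ is the set of nondegenerate forms, and $NS_A(\mathbb C)^0=\{\varphi_1+i\varphi_2\in NS_A(\mathbb C):\varphi_1\in NS_A(\mathbb R),\ \varphi_2\in NS_A(\mathbb R)^0\}$. Put $\Lambda_A=\Gamma_A\oplus\Gamma_{\hat A}$ ($\Gamma_{\hat A}=\Gamma_A^*$) with $Q_A((a_1,b_1),(a_2,b_2))=b_1(a_2)+b_2(a_1)$;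 $J_{A\times\hat A}=(J,\hat J)$ acts on $V_A\oplus V_{\hat A}$. For $\omega=\varphi_1+i\varphi_2\in NS_A(\mathbb C)^0$ (with $\varphi_k:V_A\to V_{\hat A}$) put $$I_\omega=\begin{pmatrix}\varphi_2^{-1}\varphi_1&-\varphi_2^{-1}\\ \varphi_2+\varphi_1\varphi_2^{-1}\varphi_1&-\varphi_1\varphi_2^{-1}\end{pmatrix},$$ a complex structure on $V_A\oplus V_{\hat A}$. A weak pair $(A,\omega_A)$ is a complex torus $A$ with $\omega_A\in NS_A(\mathbb C)^0$. Weak pairs $(A,\omega_A)$, $(B,\omega_B)$ are mirror symmetric if there is given an isomorphism $\alpha:\Lambda_A\to\Lambda_B$ identifying $Q_A$ with $Q_B$ such that $\alpha_{\mathbb R}J_{A\times\hat A}=I_{\omega_B}\alpha_{\mathbb R}$ and $\alpha_{\mathbb R}I_{\omega_A}=J_{B\times\hat B}\alpha_{\mathbb R}$. Clifford modules: $Cl(\Lambda_A,Q_A)=T(\Lambda_A)/\langle x\otimes x=\frac12Q_A(x,x)\rangle$ acts on $H^*(A,\mathbb Z)=\Lambda^\cdot\Gamma_A^*$ by letting $(l,x)\in\Gamma_A\oplus\Gamma_A^*$ act as contraction with $l$ plus cup product with $x$; similarly for $B$. Identifying $Cl(\Lambda_A,Q_A)$ with $Cl(\Lambda_B,Q_B)$ by $\alpha$, there is a unique up to $\pm1$ isomorphism $\beta:H^*(A,\mathbb Z)\to H^*(B,\mathbb Z)$ of modules over this Clifford algebra. It is called even if $\beta(H^{ev}(A,\mathbb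 Z))=H^{ev}(B,\mathbb Z)$ and $\beta(H^{odd}(A,\mathbb Z))=H^{odd}(B,\mathbb Z)$, and odd if $\beta(H^{ev}(A,\mathbb Z))=H^{odd}(B,\mathbb Z)$ and $\beta(H^{odd}(A,\mathbb Z))=H^{ev}(B,\mathbb Z)$; exactly one of these holds. *)

theory Defs
  imports "HOL-Analysis.Analysis" "HOL-Algebra.QuotRing"
begin

section \<open>Dual vector spaces\<close>

typedef (overloaded) 'a dual = "{f :: 'a::real_vector \<Rightarrow> real. linear f}"
  morphisms dual_app Dual
  by (rule exI[of _ "\<lambda>_. 0"]) (simp add: linear_iff)

lemma linear_dual_app: "linear (dual_app x)"
  using dual_app by auto

lemma dual_app_Dual: "linear f \<Longrightarrow> dual_app (Dual f) = f"
  by (simp add: Dual_inverse)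

lemma dual_eqI: "(\<And>v. dual_app x v = dual_app y v) \<Longrightarrow> x = y"
  by (metis dual_app_inject ext)

instantiation dual :: (real_vector) real_vector
begin

definition "0 = Dual (\<lambda>_. 0)"
definition "x + y = Dual (\<lambda>v. dual_app x v + dual_app y v)"
definition "x - y = Dual (\<lambda>v. dual_app x v - dual_app y v)"
definition "- x = Dual (\<lambda>v. - dual_app x v)"
definition "scaleR r x = Dual (\<lambda>v. r * dual_app x v)"

lemma dual_app_simps:
  "dual_app 0 v = 0"
  "dual_app (x + y) v = dual_app x v + dual_app y v"
  "dual_app (x - y) v = dual_app x v - dual_app y v"
  "dual_app (- x) v = - dual_app x v"
  "dual_app (r *\<^sub>R x) v = r * dual_app x v"
proof -
  note l = linear_dual_app[of x] linear_dual_app[of y]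
  show "dual_app 0 v = 0"
    by (simp add: zero_dual_def dual_app_Dual linear_iff)
  show "dual_app (x + y) v = dual_app x v + dual_app y v"
    using l by (simp add: plus_dual_def dual_app_Dual linear_iff algebra_simps)
  show "dual_app (x - y) v = dual_app x v - dual_app y v"
    using l by (simp add: minus_dual_def dual_app_Dual linear_iff algebra_simps)
  show "dual_app (- x) v = - dual_app x v"
    using l by (simp add: uminus_dual_def dual_app_Dual linear_iff algebra_simps)
  show "dual_app (r *\<^sub>R x) v = r * dual_app x v"
    using l by (simp add: scaleR_dual_def dual_app_Dual linear_iff algebra_simps)
qed

instance
  by standard (auto intro!: dual_eqI simp: dual_app_simps algebra_simps)

end


section \<open>Complex tori\<close>

text \<open>
  A torus is given by its lattice and its complex structure. The real vector space
  \<open>V\<close> is the whole type \<open>'a\<close>; \<open>is_lattice\<close> says that \<open>V\<close> is finite-dimensional and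
  that the inclusion of the lattice induces an isomorphism of its real scalar
  extension with \<open>V\<close>. The zero-dimensional case is allowed.
\<close>

record 'a torus =
  lat :: "'a set"
  cstr :: "'a \<Rightarrow> 'a"

definition is_lattice :: "'a::real_vector set \<Rightarrow> bool" where
  "is_lattice G \<longleftrightarrow> (\<exists>B. finite B \<and> independent B \<and> span B = UNIV \<and>
     G = range (\<lambda>k :: 'a \<Rightarrow> int. \<Sum>b\<in>B. of_int (k b) *\<^sub>R b))"

definition complex_torus :: "'a::real_vector torus \<Rightarrow> bool" where
  "complex_torus A \<longleftrightarrow>
     is_lattice (lat A) \<and> linear (cstr A) \<and> (\<forall>v. cstr A (cstr A v) = - v)"

definition torus_dim :: "'a::real_vector torus \<Rightarrow> nat" where
  "torus_dim A = dim (lat A) div 2"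

definition dual_torus :: "'a::real_vector torus \<Rightarrow> 'a dual torus" where
  "dual_torus A =
     \<lparr>lat = {x. \<forall>l\<in>lat A. dual_app x l \<in> \<int>},
      cstr = (\<lambda>w. Dual (\<lambda>v. dual_app w (- cstr A v)))\<rparr>"


section \<open>The Neron-Severi group\<close>

text \<open>Integral forms on the lattice are represented by their real bilinear extensions.\<close>

definition NS :: "'a::real_vector torus \<Rightarrow> ('a \<Rightarrow> 'a \<Rightarrow> real) set" where
  "NS A = {c. bilinear c \<and> (\<forall>u v. c u v = - c v u) \<and>
     (\<forall>u\<in>lat A. \<forall>v\<in>lat A. c u v \<in> \<int>) \<and>
     (\<forall>u v. c (cstr A u) (cstr A v) = c u v)}"

text \<open>Real span; integral forms independent over the integers are independent over the
  reals, so this is the tensor product of \<open>NS A\<close> with the reals.\<close>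

definition NS_real :: "'a::real_vector torus \<Rightarrow> ('a \<Rightarrow> 'a \<Rightarrow> real) set" where
  "NS_real A = {\<lambda>u v. \<Sum>c\<in>S. r c * c u v | S r. finite S \<and> S \<subseteq> NS A}"

definition NS_real0 :: "'a::real_vector torus \<Rightarrow> ('a \<Rightarrow> 'a \<Rightarrow> real) set" where
  "NS_real0 A = {c \<in> NS_real A. \<forall>u. (\<forall>v. c u v = 0) \<longrightarrow> u = 0}"

definition NS_complex0 :: "'a::real_vector torus \<Rightarrow> ('a \<Rightarrow> 'a \<Rightarrow> complex) set" where
  "NS_complex0 A = {\<lambda>u v. complex_of_real (c1 u v) + \<i> * complex_of_real (c2 u v) | c1 c2.
     c1 \<in> NS_real A \<and> c2 \<in> NS_real0 A}"

definition form_hom :: "('a::real_vector \<Rightarrow> 'a \<Rightarrow> real) \<Rightarrow> 'a \<Rightarrow> 'a dual" where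
  "form_hom c v = Dual (c v)"


section \<open>Weak pairs and mirror symmetry\<close>

definition weak_pair :: "'a::real_vector torus \<Rightarrow> ('a \<Rightarrow> 'a \<Rightarrow> complex) \<Rightarrow> bool" where
  "weak_pair A \<omega> \<longleftrightarrow> complex_torus A \<and> \<omega> \<in> NS_complex0 A"

definition Lam :: "'a::real_vector torus \<Rightarrow> ('a \<times> 'a dual) set" where
  "Lam A = lat A \<times> lat (dual_torus A)"

definition Qform :: "'a::real_vector \<times> 'a dual \<Rightarrow> 'a \<times> 'a dual \<Rightarrow> real" where
  "Qform p q = dual_app (snd p) (fst q) + dual_app (snd q) (fst p)"

definition J_prod :: "'a::real_vector torus \<Rightarrow> 'a \<times> 'a dual \<Rightarrow> 'a \<times> 'a dual" where
  "J_prod A = map_prod (cstr A) (cstr (dual_torus A))"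

definition I_om :: "('a::real_vector \<Rightarrow> 'a \<Rightarrow> complex) \<Rightarrow> 'a \<times> 'a dual \<Rightarrow> 'a \<times> 'a dual" where
  "I_om \<omega> = (let f1 = form_hom (\<lambda>u v. Re (\<omega> u v));
                 f2 = form_hom (\<lambda>u v. Im (\<omega> u v))
             in (\<lambda>(v, w). (inv_into UNIV f2 (f1 v) - inv_into UNIV f2 w,
                           f2 v + f1 (inv_into UNIV f2 (f1 v)) - f1 (inv_into UNIV f2 w))))"

definition lattice_isometry ::
  "'a::real_vector torus \<Rightarrow> 'b::real_vector torus \<Rightarrow> ('a \<times> 'a dual \<Rightarrow> 'b \<times> 'b dual) \<Rightarrow> bool" where
  "lattice_isometry A B \<alpha> \<longleftrightarrow> bij_betw \<alpha> (Lam A) (Lam B) \<and>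
     (\<forall>p\<in>Lam A. \<forall>q\<in>Lam A. \<alpha> (p + q) = \<alpha> p + \<alpha> q) \<and>
     (\<forall>p\<in>Lam A. \<forall>q\<in>Lam A. Qform (\<alpha> p) (\<alpha> q) = Qform p q)"

text \<open>Only the values of \<open>\<alpha>\<close> on \<open>Lam A\<close> matter; \<open>\<alpha>R\<close> is its unique real linear extension.\<close>

definition mirror_symmetry ::
  "'a::real_vector torus \<Rightarrow> ('a \<Rightarrow> 'a \<Rightarrow> complex) \<Rightarrow>
   'b::real_vector torus \<Rightarrow> ('b \<Rightarrow> 'b \<Rightarrow> complex) \<Rightarrow>
   ('a \<times> 'a dual \<Rightarrow> 'b \<times> 'b dual) \<Rightarrow> bool" where
  "mirror_symmetry A \<omega> B \<eta> \<alpha> \<longleftrightarrow> lattice_isometry A B \<alpha> \<and>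
     (\<exists>\<alpha>R. linear \<alpha>R \<and> (\<forall>p\<in>Lam A. \<alpha>R p = \<alpha> p) \<and>
       \<alpha>R \<circ> J_prod A = I_om \<eta> \<circ> \<alpha>R \<and>
       \<alpha>R \<circ> I_om \<omega> = J_prod B \<circ> \<alpha>R)"


section \<open>Clifford rings\<close>

text \<open>The free associative ring on a set \<open>X\<close>: integral combinations of words.\<close>

definition word_splits :: "'x list \<Rightarrow> ('x list \<times> 'x list) set" where
  "word_splits w = {(u, v). u @ v = w}"

definition free_ring :: "'x set \<Rightarrow> ('x list \<Rightarrow> int) ring" where
  "free_ring X =
     \<lparr>carrier = {f. finite {w. f w \<noteq> 0} \<and> (\<forall>w. f w \<noteq> 0 \<longrightarrow> set w \<subseteq> X)},
      mult = (\<lambda>f g w. \<Sum>(u, v)\<in>word_splits w. f u * g v),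
      one = (\<lambda>w. if w = [] then 1 else 0),
      zero = (\<lambda>w. 0),
      add = (\<lambda>f g w. f w + g w)\<rparr>"

definition word :: "'x list \<Rightarrow> 'x list \<Rightarrow> int" where
  "word u = (\<lambda>w. if w = u then 1 else 0)"

text \<open>The relations \<open>[x + y] - [x] - [y]\<close> present the tensor ring of the abelian group \<open>L\<close>;
  the others are the Clifford relations \<open>x \<otimes> x = Q(x, x) / 2\<close>.\<close>

definition tensor_relations :: "'x::ab_group_add set \<Rightarrow> ('x list \<Rightarrow> int) set" where
  "tensor_relations L = {\<lambda>w. word [x + y] w - word [x] w - word [y] w | x y. x \<in> L \<and> y \<in> L}"

definition square_relations ::
  "'x::ab_group_add set \<Rightarrow> ('x \<Rightarrow> 'x \<Rightarrow> real) \<Rightarrow> ('x list \<Rightarrow> int) set" where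
  "square_relations L Q =
     {\<lambda>w. word [x, x] w - k * word [] w | x k. x \<in> L \<and> of_int k = Q x x / 2}"

definition clifford_ideal ::
  "'x::ab_group_add set \<Rightarrow> ('x \<Rightarrow> 'x \<Rightarrow> real) \<Rightarrow> ('x list \<Rightarrow> int) set" where
  "clifford_ideal L Q =
     Idl\<^bsub>free_ring L\<^esub> (tensor_relations L \<union> square_relations L Q)"

definition clifford_ring ::
  "'x::ab_group_add set \<Rightarrow> ('x \<Rightarrow> 'x \<Rightarrow> real) \<Rightarrow> ('x list \<Rightarrow> int) set ring" where
  "clifford_ring L Q = free_ring L Quot clifford_ideal L Q"

definition clifford_class ::
  "'x::ab_group_add set \<Rightarrow> ('x \<Rightarrow> 'x \<Rightarrow> real) \<Rightarrow> ('x list \<Rightarrow> int) \<Rightarrow> ('x list \<Rightarrow> int) set" where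
  "clifford_class L Q f = clifford_ideal L Q +>\<^bsub>free_ring L\<^esub> f"

abbreviation clifford_gen ::
  "'x::ab_group_add set \<Rightarrow> ('x \<Rightarrow> 'x \<Rightarrow> real) \<Rightarrow> 'x \<Rightarrow> ('x list \<Rightarrow> int) set" where
  "clifford_gen L Q x \<equiv> clifford_class L Q (word [x])"


section \<open>Cohomology of a torus as a Clifford module\<close>

text \<open>The exterior algebra of the dual lattice is realised as the group of alternating
  multilinear forms that are integral on the lattice. A form \<open>m\<close> carries all its homogeneous
  components: the one of degree \<open>k\<close> is the restriction of \<open>m\<close> to lists of length \<open>k\<close>; it
  vanishes for \<open>k\<close> greater than the rank of the lattice.\<close>

definition alt_form :: "('a::real_vector list \<Rightarrow> real) \<Rightarrow> bool" where
  "alt_form m \<longleftrightarrow> (\<forall>us vs. linear (\<lambda>v. m (us @ v # vs))) \<and> (\<forall>vs. \<not> distinct vs \<longrightarrow> m vs = 0)"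

definition coh :: "'a::real_vector torus \<Rightarrow> ('a list \<Rightarrow> real) set" where
  "coh A = {m. alt_form m \<and> (\<forall>vs. set vs \<subseteq> lat A \<longrightarrow> m vs \<in> \<int>)}"

definition coh_ev :: "'a::real_vector torus \<Rightarrow> ('a list \<Rightarrow> real) set" where
  "coh_ev A = {m \<in> coh A. \<forall>vs. odd (length vs) \<longrightarrow> m vs = 0}"

definition coh_odd :: "'a::real_vector torus \<Rightarrow> ('a list \<Rightarrow> real) set" where
  "coh_odd A = {m \<in> coh A. \<forall>vs. even (length vs) \<longrightarrow> m vs = 0}"

definition contract :: "'a \<Rightarrow> ('a list \<Rightarrow> real) \<Rightarrow> 'a list \<Rightarrow> real" where
  "contract l m vs = m (l # vs)"

definition cup1 :: "'a::real_vector dual \<Rightarrow> ('a list \<Rightarrow> real) \<Rightarrow> 'a list \<Rightarrow> real" where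
  "cup1 x m vs =
     (\<Sum>i<length vs. (-1) ^ i * dual_app x (vs ! i) * m (take i vs @ drop (Suc i) vs))"

text \<open>The action of the generator \<open>(l, x)\<close>: contraction with \<open>l\<close> plus cup product with \<open>x\<close>.\<close>

definition spin :: "'a::real_vector \<times> 'a dual \<Rightarrow> ('a list \<Rightarrow> real) \<Rightarrow> 'a list \<Rightarrow> real" where
  "spin p m vs = contract (fst p) m vs + cup1 (snd p) m vs"

definition word_act ::
  "('a::real_vector \<times> 'a dual) list \<Rightarrow> ('a list \<Rightarrow> real) \<Rightarrow> 'a list \<Rightarrow> real" where
  "word_act w m = foldr spin w m"

definition free_act ::
  "(('a::real_vector \<times> 'a dual) list \<Rightarrow> int) \<Rightarrow> ('a list \<Rightarrow> real) \<Rightarrow> 'a list \<Rightarrow> real" where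
  "free_act f m vs = (\<Sum>w | f w \<noteq> 0. of_int (f w) * word_act w m vs)"

text \<open>The action of a class is that of any of its representatives; it is well defined for
  \<open>m \<in> coh A\<close> by \<open>clifford_act_class\<close> below.\<close>

definition clifford_act ::
  "(('a::real_vector \<times> 'a dual) list \<Rightarrow> int) set \<Rightarrow> ('a list \<Rightarrow> real) \<Rightarrow> 'a list \<Rightarrow> real" where
  "clifford_act c m = (THE m'. \<exists>f\<in>c. m' = free_act f m)"

text \<open>\<open>\<theta>\<close> is the identification of the two Clifford rings induced by \<open>\<alpha>\<close>; it exists and is
  unique by the universal property of the Clifford ring.\<close>

definition clifford_module_iso ::
  "'a::real_vector torus \<Rightarrow> 'b::real_vector torus \<Rightarrow> ('a \<times> 'a dual \<Rightarrow> 'b \<times> 'b dual) \<Rightarrow>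
   (('a list \<Rightarrow> real) \<Rightarrow> 'b list \<Rightarrow> real) \<Rightarrow> bool" where
  "clifford_module_iso A B \<alpha> \<beta> \<longleftrightarrow>
     bij_betw \<beta> (coh A) (coh B) \<and>
     (\<forall>m\<in>coh A. \<forall>m'\<in>coh A. \<beta> (\<lambda>vs. m vs + m' vs) = (\<lambda>vs. \<beta> m vs + \<beta> m' vs)) \<and>
     (\<exists>\<theta>\<in>ring_iso (clifford_ring (Lam A) Qform) (clifford_ring (Lam B) Qform).
        (\<forall>p\<in>Lam A. \<theta> (clifford_gen (Lam A) Qform p) = clifford_gen (Lam B) Qform (\<alpha> p)) \<and>
        (\<forall>c\<in>carrier (clifford_ring (Lam A) Qform). \<forall>m\<in>coh A.
           \<beta> (clifford_act c m) = clifford_act (\<theta> c) (\<beta> m)))"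

definition even_iso ::
  "'a::real_vector torus \<Rightarrow> 'b::real_vector torus \<Rightarrow>
   (('a list \<Rightarrow> real) \<Rightarrow> 'b list \<Rightarrow> real) \<Rightarrow> bool" where
  "even_iso A B \<beta> \<longleftrightarrow> \<beta> ` coh_ev A = coh_ev B \<and> \<beta> ` coh_odd A = coh_odd B"

definition odd_iso ::
  "'a::real_vector torus \<Rightarrow> 'b::real_vector torus \<Rightarrow>
   (('a list \<Rightarrow> real) \<Rightarrow> 'b list \<Rightarrow> real) \<Rightarrow> bool" where
  "odd_iso A B \<beta> \<longleftrightarrow> \<beta> ` coh_ev A = coh_odd B \<and> \<beta> ` coh_odd A = coh_ev B"


section \<open>The Clifford action is well defined\<close>

lemma cup1_Nil: "cup1 x m [] = 0"
  by (simp add: cup1_def)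

lemma cup1_Cons: "cup1 x m (l # vs) = dual_app x l * m vs - cup1 x (contract l m) vs"
  by (simp add: cup1_def contract_def sum.lessThan_Suc_shift sum_negf[symmetric] del: sum.lessThan_Suc)

lemma contract_cup1: "contract l (cup1 x m) = (\<lambda>vs. dual_app x l * m vs - cup1 x (contract l m) vs)"
  by (rule ext) (simp only: contract_def[of l "cup1 x m"] cup1_Cons)

lemma cup1_lin:
  "cup1 x (\<lambda>vs. a * m vs + b * m' vs) vs = a * cup1 x m vs + b * cup1 x m' vs"
  unfolding cup1_def sum_distrib_left sum.distrib[symmetric]
  by (rule sum.cong) (simp_all add: algebra_simps)

lemma cup1_diff: "cup1 x (\<lambda>vs. a * m vs - m' vs) vs = a * cup1 x m vs - cup1 x m' vs"
  using cup1_lin[of x a m "-1" m' vs] by simp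

lemma cup1_cup1: "cup1 x (cup1 x m) vs = 0"
proof (induction vs arbitrary: m)
  case Nil
  show ?case by (simp add: cup1_Nil)
next
  case (Cons l vs)
  show ?case
    by (simp add: cup1_Cons contract_cup1 cup1_diff Cons.IH)
qed

lemma alt_form_linear: "alt_form m \<Longrightarrow> linear (\<lambda>v. m (us @ v # vs))"
  by (simp add: alt_form_def)

lemma alt_form_rep: "alt_form m \<Longrightarrow> \<not> distinct vs \<Longrightarrow> m vs = 0"
  by (simp add: alt_form_def)

lemma alt_form_contract:
  assumes "alt_form m"
  shows "alt_form (contract l m)"
  unfolding alt_form_def contract_def
proof (intro conjI allI impI)
  show "linear (\<lambda>v. m (l # us @ v # vs))" for us vs
    using alt_form_linear[OF assms, of "l # us" vs] by simp
  show "m (l # vs) = 0" if "\<not> distinct vs" for vs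
    using that by (intro alt_form_rep[OF assms]) simp
qed

lemma contract_rep: "alt_form m \<Longrightarrow> contract l (contract l m) = (\<lambda>_. 0)"
  by (rule ext) (simp add: contract_def alt_form_rep[of m])

lemma contract_anti:
  assumes "alt_form m"
  shows "contract l (contract l' m) vs = - contract l' (contract l m) vs"
proof -
  have L: "m (us @ (x + y) # ws) = m (us @ x # ws) + m (us @ y # ws)" for us x y ws
    using alt_form_linear[OF assms, of us ws] by (simp add: linear_iff)
  have "0 = m ((l + l') # (l + l') # vs)"
    by (simp add: alt_form_rep[OF assms])
  also have "\<dots> = m (l # l # vs) + m (l # l' # vs) + m (l' # l # vs) + m (l' # l' # vs)"
    using L[of "[]" l l'] L[of "[l]" l l'] L[of "[l']" l l'] by simp
  finally show ?thesis
    by (simp add: contract_def alt_form_rep[OF assms])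
qed

lemma cup1_cancel:
  assumes "alt_form m"
  shows "cup1 x (contract l m) (ws @ l # zs) = dual_app x l * m (ws @ l # zs)"
  using assms
proof (induction ws arbitrary: m)
  case Nil
  show ?case
    unfolding append_Nil cup1_Cons contract_rep[OF Nil]
    by (simp only: contract_def cup1_def mult_zero_right sum.neutral_const diff_zero)
next
  case (Cons w ws)
  have "contract w (contract l m) = (\<lambda>vs. (-1) * contract l (contract w m) vs + 0 * m vs)"
    by (rule ext) (simp add: contract_anti[OF Cons.prems, of w l])
  then have "cup1 x (contract w (contract l m)) (ws @ l # zs)
      = (-1) * cup1 x (contract l (contract w m)) (ws @ l # zs) + 0 * cup1 x m (ws @ l # zs)"
    by (metis cup1_lin)
  also have "\<dots> = - (dual_app x l * m (w # ws @ l # zs))"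
    using Cons.IH[OF alt_form_contract[OF Cons.prems, of w]]
    by (simp add: contract_def[of w m "ws @ l # zs"])
  finally have *: "cup1 x (contract w (contract l m)) (ws @ l # zs) = - (dual_app x l * m (w # ws @ l # zs))" .
  have "m (l # ws @ l # zs) = 0"
    by (simp add: alt_form_rep[OF Cons.prems])
  then show ?case
    unfolding append_Cons cup1_Cons contract_def[of l m "ws @ l # zs"] * by simp
qed

lemma cup1_rep:
  assumes "alt_form m"
  shows "cup1 x m (us @ l # ws @ l # zs) = 0"
  using assms
proof (induction us arbitrary: m)
  case Nil
  then show ?case by (simp add: cup1_Cons cup1_cancel)
next
  case (Cons u us)
  have "m (us @ l # ws @ l # zs) = 0"
    by (simp add: alt_form_rep[OF Cons.prems])
  then show ?case
    using Cons.IH[OF alt_form_contract[OF Cons.prems]] by (simp add: cup1_Cons)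
qed

lemma cup1_linear:
  assumes "alt_form m"
  shows "linear (\<lambda>v. cup1 x m (us @ v # vs))"
  using assms
proof (induction us arbitrary: m)
  case Nil
  have c: "contract (a + b) m = (\<lambda>vs. 1 * contract a m vs + 1 * contract b m vs)"
    "contract (r *\<^sub>R a) m = (\<lambda>vs. r * contract a m vs + 0 * contract a m vs)" for a b r
    using alt_form_linear[OF Nil, of "[]"] by (auto simp: contract_def linear_iff)
  show ?case
    unfolding linear_iff append_Nil cup1_Cons c cup1_lin
    using linear_dual_app[of x] by (auto simp: linear_iff algebra_simps)
next
  case (Cons u us)
  show ?case
    using alt_form_linear[OF Cons.prems, of us vs]
      Cons.IH[OF alt_form_contract[OF Cons.prems], of u]
    by (simp add: cup1_Cons linear_iff algebra_simps)
qed

lemma alt_form_cup1: "alt_form m \<Longrightarrow> alt_form (cup1 x m)"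
  unfolding alt_form_def[of "cup1 x m"]
  by (auto simp: cup1_linear cup1_rep dest!: not_distinct_decomp)

lemma alt_form_lin:
  "alt_form m \<Longrightarrow> alt_form m' \<Longrightarrow> alt_form (\<lambda>vs. a * m vs + b * m' vs)"
  by (auto simp: alt_form_def linear_iff algebra_simps)

lemma spin_spin:
  assumes "alt_form m"
  shows "spin p (spin p m) vs = Qform p p / 2 * m vs"
proof -
  let ?l = "fst p" and ?x = "snd p"
  have s: "spin p m = (\<lambda>vs. 1 * contract ?l m vs + 1 * cup1 ?x m vs)"
    by (rule ext) (simp add: spin_def)
  have 1: "cup1 ?x (spin p m) vs = cup1 ?x (contract ?l m) vs + cup1 ?x (cup1 ?x m) vs"
    unfolding s cup1_lin by simp
  have 2: "contract ?l (spin p m) vs = contract ?l (contract ?l m) vs + contract ?l (cup1 ?x m) vs"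
    by (simp only: contract_def[of ?l "spin p m"] contract_def[of ?l "contract ?l m"]
        contract_def[of ?l "cup1 ?x m"] spin_def)
  show ?thesis
    unfolding spin_def[of p "spin p m"] 1 2
    by (simp add: contract_rep[OF assms] contract_cup1 cup1_cup1 Qform_def)
qed

lemma coh_lin:
  "m \<in> coh A \<Longrightarrow> m' \<in> coh A \<Longrightarrow> a \<in> \<int> \<Longrightarrow> b \<in> \<int> \<Longrightarrow> (\<lambda>vs. a * m vs + b * m' vs) \<in> coh A"
  by (auto simp: coh_def alt_form_lin)

lemma spin_coh:
  assumes "p \<in> Lam A" "m \<in> coh A"
  shows "spin p m \<in> coh A"
proof -
  have p: "fst p \<in> lat A" "l \<in> lat A \<Longrightarrow> dual_app (snd p) l \<in> \<int>" for l
    using assms(1) by (auto simp: Lam_def dual_torus_def)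
  have m: "alt_form m" "set vs \<subseteq> lat A \<Longrightarrow> m vs \<in> \<int>" for vs
    using assms(2) by (auto simp: coh_def)
  have 1: "contract (fst p) m \<in> coh A"
    using m p by (auto simp: coh_def alt_form_contract) (simp add: contract_def)
  have "dual_app (snd p) (vs ! i) * m (take i vs @ drop (Suc i) vs) \<in> \<int>"
    if "set vs \<subseteq> lat A" "i < length vs" for vs i
  proof (rule Ints_mult)
    show "dual_app (snd p) (vs ! i) \<in> \<int>"
      using that nth_mem[of i vs] by (intro p(2)) blast
    show "m (take i vs @ drop (Suc i) vs) \<in> \<int>"
      using that set_take_subset[of i vs] set_drop_subset[of "Suc i" vs]
      by (intro m(2)) auto
  qed
  then have 2: "cup1 (snd p) m \<in> coh A"
    using m(1) by (auto simp: coh_def alt_form_cup1 cup1_def mult.assoc intro!: Ints_sum)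
  have "spin p m = (\<lambda>vs. 1 * contract (fst p) m vs + 1 * cup1 (snd p) m vs)"
    by (auto simp: spin_def)
  with coh_lin[OF 1 2, of 1 1] show ?thesis by simp
qed


lemma finite_word_splits: "finite (word_splits w)"
proof -
  have "word_splits w \<subseteq> (\<lambda>i. (take i w, drop i w)) ` {..length w}"
  proof
    fix uv assume "uv \<in> word_splits w"
    then have "fst uv @ snd uv = w" by (auto simp: word_splits_def)
    then have "uv = (take (length (fst uv)) w, drop (length (fst uv)) w)" "length (fst uv) \<le> length w"
      by (auto simp: prod_eq_iff)
    then show "uv \<in> (\<lambda>i. (take i w, drop i w)) ` {..length w}" by blast
  qed
  then show ?thesis by (rule finite_subset) simp
qed

lemma free_mult_supp:
  "{w. (\<Sum>(u, v)\<in>word_splits w. f u * g v) \<noteq> (0::int)}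
     \<subseteq> (\<lambda>(u, v). u @ v) ` ({u. f u \<noteq> 0} \<times> {v. g v \<noteq> 0})"
proof
  fix w assume "w \<in> {w. (\<Sum>(u, v)\<in>word_splits w. f u * g v) \<noteq> (0::int)}"
  then have "\<exists>p\<in>word_splits w. (case p of (u, v) \<Rightarrow> f u * g v) \<noteq> 0"
    by (metis (mono_tags, lifting) mem_Collect_eq sum.neutral)
  then show "w \<in> (\<lambda>(u, v). u @ v) ` ({u. f u \<noteq> 0} \<times> {v. g v \<noteq> 0})"
    by (force simp: word_splits_def)
qed

lemma free_mult_assoc:
  fixes f g h :: "'x list \<Rightarrow> int"
  shows "(\<Sum>(p, z)\<in>word_splits w. (\<Sum>(x, y)\<in>word_splits p. f x * g y) * h z) =
    (\<Sum>(x, q)\<in>word_splits w. f x * (\<Sum>(y, z)\<in>word_splits q. g y * h z))"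
proof -
  have "(\<Sum>(p, z)\<in>word_splits w. (\<Sum>(x, y)\<in>word_splits p. f x * g y) * h z)
      = (\<Sum>pz\<in>word_splits w. \<Sum>xy\<in>word_splits (fst pz). f (fst xy) * g (snd xy) * h (snd pz))"
    by (simp add: sum_distrib_right case_prod_unfold)
  also have "\<dots> = (\<Sum>(pz, xy)\<in>(SIGMA pz:word_splits w. word_splits (fst pz)).
      f (fst xy) * g (snd xy) * h (snd pz))"
    by (intro sum.Sigma) (auto simp: finite_word_splits)
  also have "\<dots> = (\<Sum>(xq, yz)\<in>(SIGMA xq:word_splits w. word_splits (snd xq)).
      f (fst xq) * (g (fst yz) * h (snd yz)))"
    by (rule sum.reindex_bij_witness
        [where i = "\<lambda>(xq, yz). ((fst xq @ fst yz, snd yz), (fst xq, fst yz))"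
          and j = "\<lambda>(pz, xy). ((fst xy, snd xy @ snd pz), (snd xy, snd pz))"])
      (auto simp: word_splits_def mult.assoc)
  also have "\<dots> = (\<Sum>xq\<in>word_splits w. \<Sum>yz\<in>word_splits (snd xq). f (fst xq) * (g (fst yz) * h (snd yz)))"
    by (intro sum.Sigma[symmetric]) (auto simp: finite_word_splits)
  also have "\<dots> = (\<Sum>(x, q)\<in>word_splits w. f x * (\<Sum>(y, z)\<in>word_splits q. g y * h z))"
    by (simp add: sum_distrib_left case_prod_unfold)
  finally show ?thesis .
qed

lemma free_mult_one:
  fixes g :: "'x list \<Rightarrow> int"
  shows "(\<Sum>(u, v)\<in>word_splits w. (if u = [] then 1 else 0) * g v) = g w"
    and "(\<Sum>(u, v)\<in>word_splits w. g u * (if v = [] then 1 else 0)) = g w"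
proof -
  have "(\<Sum>(u, v)\<in>word_splits w. (if u = [] then 1 else 0) * g v)
      = (\<Sum>(u, v)\<in>{([] :: 'x list, w)}. (if u = [] then 1 else 0) * g v)"
    by (rule sum.mono_neutral_right[OF finite_word_splits]) (auto simp: word_splits_def split: if_splits)
  then show "(\<Sum>(u, v)\<in>word_splits w. (if u = [] then 1 else 0) * g v) = g w" by simp
  have "(\<Sum>(u, v)\<in>word_splits w. g u * (if v = [] then 1 else 0))
      = (\<Sum>(u, v)\<in>{(w, [] :: 'x list)}. g u * (if v = [] then 1 else 0))"
    by (rule sum.mono_neutral_right[OF finite_word_splits]) (auto simp: word_splits_def split: if_splits)
  then show "(\<Sum>(u, v)\<in>word_splits w. g u * (if v = [] then 1 else 0)) = g w" by simp
qed

lemma free_ring_simps: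
  "f \<oplus>\<^bsub>free_ring X\<^esub> g = (\<lambda>w. f w + g w)"
  "f \<otimes>\<^bsub>free_ring X\<^esub> g = (\<lambda>w. \<Sum>(u, v)\<in>word_splits w. f u * g v)"
  "\<zero>\<^bsub>free_ring X\<^esub> = (\<lambda>w. 0)"
  "\<one>\<^bsub>free_ring X\<^esub> = (\<lambda>w. if w = [] then 1 else 0)"
  by (simp_all add: free_ring_def)

lemma free_ring_carrier:
  "f \<in> carrier (free_ring X) \<longleftrightarrow> finite {w. f w \<noteq> 0} \<and> {w. f w \<noteq> 0} \<subseteq> lists X"
  by (auto simp: free_ring_def)

lemma free_ring_add_closed:
  assumes "f \<in> carrier (free_ring X)" "g \<in> carrier (free_ring X)"
  shows "(\<lambda>w. f w + a * g w) \<in> carrier (free_ring X)"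
proof -
  have "{w. f w + a * g w \<noteq> 0} \<subseteq> {w. f w \<noteq> 0} \<union> {w. g w \<noteq> 0}" by auto
  then show ?thesis
    using assms unfolding free_ring_carrier
    by (meson Un_least finite_UnI finite_subset order_trans)
qed

lemma free_ring_mult_closed:
  assumes "f \<in> carrier (free_ring X)" "g \<in> carrier (free_ring X)"
  shows "(\<lambda>w. \<Sum>(u, v)\<in>word_splits w. f u * g v) \<in> carrier (free_ring X)"
proof -
  let ?P = "(\<lambda>(u, v). u @ v) ` ({u. f u \<noteq> 0} \<times> {v. g v \<noteq> 0})"
  have "finite ?P" "?P \<subseteq> lists X"
    using assms unfolding free_ring_carrier by (auto simp: subset_iff in_lists_conv_set)
  then show ?thesis
    unfolding free_ring_carrier using free_mult_supp[of f g]
    by (meson finite_subset order_trans)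
qed

lemma ring_free_ring: "ring (free_ring X)"
proof (rule ringI)
  show "abelian_group (free_ring X)"
  proof (rule abelian_groupI)
    fix f assume "f \<in> carrier (free_ring X)"
    then have "(\<lambda>w. - f w) \<in> carrier (free_ring X)"
      by (simp add: free_ring_carrier)
    then show "\<exists>g\<in>carrier (free_ring X). g \<oplus>\<^bsub>free_ring X\<^esub> f = \<zero>\<^bsub>free_ring X\<^esub>"
      by (intro bexI[of _ "\<lambda>w. - f w"]) (simp_all add: free_ring_simps)
  next
    fix f g assume "f \<in> carrier (free_ring X)" "g \<in> carrier (free_ring X)"
    then show "f \<oplus>\<^bsub>free_ring X\<^esub> g \<in> carrier (free_ring X)"
      using free_ring_add_closed[of f X g 1] by (simp add: free_ring_simps)
  next
    show "\<zero>\<^bsub>free_ring X\<^esub> \<in> carrier (free_ring X)"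
      by (simp add: free_ring_simps free_ring_carrier)
  qed (simp_all add: free_ring_simps add_ac)
  show "monoid (free_ring X)"
  proof (rule monoidI)
    show "\<one>\<^bsub>free_ring X\<^esub> \<in> carrier (free_ring X)"
      by (simp add: free_ring_simps free_ring_carrier)
  qed (simp_all add: free_ring_simps free_mult_assoc free_mult_one free_ring_mult_closed)
qed (simp_all add: free_ring_simps case_prod_unfold distrib_left distrib_right sum.distrib)

lemma free_act_superset:
  assumes "finite S" "{w. f w \<noteq> 0} \<subseteq> S"
  shows "free_act f m vs = (\<Sum>w\<in>S. of_int (f w) * word_act w m vs)"
  unfolding free_act_def by (rule sum.mono_neutral_left) (use assms in auto)

lemma free_act_word: "free_act (word u) m = word_act u m"
  by (rule ext) (simp add: free_act_superset[of "{u}"] word_def)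

lemma spin_sum:
  "spin p (\<lambda>vs. \<Sum>i\<in>S. a i * F i vs) vs = (\<Sum>i\<in>S. a i * spin p (F i) vs)"
proof -
  have "cup1 x (\<lambda>vs. \<Sum>i\<in>S. a i * F i vs) vs = (\<Sum>i\<in>S. a i * cup1 x (F i) vs)" for x
    unfolding cup1_def sum_distrib_left
    by (subst sum.swap) (simp add: mult_ac)
  then show ?thesis
    unfolding spin_def distrib_left sum.distrib by (simp add: contract_def)
qed

lemma word_act_sum:
  "word_act w (\<lambda>vs. \<Sum>i\<in>S. a i * F i vs) = (\<lambda>vs. \<Sum>i\<in>S. a i * word_act w (F i) vs)"
proof (induction w)
  case Nil
  show ?case by (simp add: word_act_def)
next
  case (Cons p w)
  have C: "word_act (p # w) m = spin p (word_act w m)" for m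
    by (simp add: word_act_def)
  show ?case
    unfolding C Cons.IH by (rule ext) (rule spin_sum)
qed

lemma word_act_append: "word_act (u @ v) m = word_act u (word_act v m)"
  by (simp add: word_act_def)

lemma free_act_mult:
  assumes "f \<in> carrier (free_ring X)" "g \<in> carrier (free_ring X)"
  shows "free_act (f \<otimes>\<^bsub>free_ring X\<^esub> g) m = free_act f (free_act g m)"
proof
  fix vs
  let ?F = "{u. f u \<noteq> 0}" and ?G = "{v. g v \<noteq> 0}"
  let ?h = "\<lambda>(u, v). real_of_int (f u) * of_int (g v) * word_act (u @ v) m vs"
  let ?W = "(\<lambda>(u, v). u @ v) ` (?F \<times> ?G)"
  have fin: "finite ?F" "finite ?G" "finite (?F \<times> ?G)" "finite ?W"
    using assms by (simp_all add: free_ring_carrier)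
  have "free_act (f \<otimes>\<^bsub>free_ring X\<^esub> g) m vs
      = (\<Sum>w\<in>?W. of_int (\<Sum>(u, v)\<in>word_splits w. f u * g v) * word_act w m vs)"
    using free_act_superset[OF fin(4) free_mult_supp] by (simp add: free_ring_simps)
  also have "\<dots> = (\<Sum>w\<in>?W. sum ?h {p \<in> ?F \<times> ?G. (case p of (u, v) \<Rightarrow> u @ v) = w})"
  proof (rule sum.cong[OF refl])
    fix w
    have "of_int (\<Sum>(u, v)\<in>word_splits w. f u * g v) * word_act w m vs = sum ?h (word_splits w)"
      by (auto simp: sum_distrib_right word_splits_def case_prod_unfold intro!: sum.cong)
    also have "\<dots> = sum ?h {p \<in> ?F \<times> ?G. (case p of (u, v) \<Rightarrow> u @ v) = w}"
      by (rule sum.mono_neutral_right[OF finite_word_splits]) (auto simp: word_splits_def)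
    finally show "of_int (\<Sum>(u, v)\<in>word_splits w. f u * g v) * word_act w m vs
      = sum ?h {p \<in> ?F \<times> ?G. (case p of (u, v) \<Rightarrow> u @ v) = w}" .
  qed
  also have "\<dots> = sum ?h (?F \<times> ?G)"
    by (rule sum.group[OF fin(3,4) order_refl])
  also have "\<dots> = (\<Sum>u\<in>?F. \<Sum>v\<in>?G. real_of_int (f u) * of_int (g v) * word_act (u @ v) m vs)"
    by (simp add: sum.cartesian_product)
  also have "\<dots> = free_act f (free_act g m) vs"
  proof -
    have g: "free_act g m = (\<lambda>vs. \<Sum>v\<in>?G. of_int (g v) * word_act v m vs)"
      by (rule ext) (simp add: free_act_def)
    show ?thesis
      unfolding free_act_def[of f] g word_act_sum word_act_append
      by (simp add: sum_distrib_left mult.assoc)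
  qed
  finally show "free_act (f \<otimes>\<^bsub>free_ring X\<^esub> g) m vs = free_act f (free_act g m) vs" .
qed

lemma free_act_add:
  assumes "f \<in> carrier (free_ring X)" "g \<in> carrier (free_ring X)"
  shows "free_act (\<lambda>w. f w + a * g w) m vs = free_act f m vs + of_int a * free_act g m vs"
proof -
  let ?S = "{w. f w \<noteq> 0} \<union> {w. g w \<noteq> 0}"
  have "finite ?S" using assms by (simp add: free_ring_carrier)
  then have S: "free_act h m vs = (\<Sum>w\<in>?S. of_int (h w) * word_act w m vs)"
    if "\<And>w. f w = 0 \<Longrightarrow> g w = 0 \<Longrightarrow> h w = 0" for h
    by (rule free_act_superset) (use that in auto)
  have "free_act (\<lambda>w. f w + a * g w) m vs = (\<Sum>w\<in>?S. of_int (f w + a * g w) * word_act w m vs)"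
    "free_act f m vs = (\<Sum>w\<in>?S. of_int (f w) * word_act w m vs)"
    "free_act g m vs = (\<Sum>w\<in>?S. of_int (g w) * word_act w m vs)"
    by (rule S; simp)+
  then show ?thesis
    by (simp add: sum_distrib_left sum.distrib algebra_simps)
qed

lemma word_carrier: "set u \<subseteq> X \<Longrightarrow> word u \<in> carrier (free_ring X)"
  by (auto simp: free_ring_carrier word_def)

lemma zero_coh: "(\<lambda>_. 0) \<in> coh A"
  by (auto simp: coh_def alt_form_def linear_iff)

lemma word_act_coh: "set w \<subseteq> Lam A \<Longrightarrow> m \<in> coh A \<Longrightarrow> word_act w m \<in> coh A"
  by (induction w) (auto simp: word_act_def spin_coh)

lemma free_act_coh:
  assumes "f \<in> carrier (free_ring (Lam A))" "m \<in> coh A"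
  shows "free_act f m \<in> coh A"
proof -
  have "(\<lambda>vs. \<Sum>w\<in>S. of_int (f w) * word_act w m vs) \<in> coh A"
    if "finite S" "S \<subseteq> lists (Lam A)" for S
    using that
  proof induction
    case empty
    show ?case by (simp add: zero_coh)
  next
    case (insert w S)
    then have "word_act w m \<in> coh A" "(\<lambda>vs. \<Sum>w\<in>S. of_int (f w) * word_act w m vs) \<in> coh A"
      using word_act_coh[OF _ assms(2)] by (auto simp: in_lists_conv_set subset_iff)
    from coh_lin[OF this, of "of_int (f w)" 1] show ?case
      using insert by simp
  qed
  then show ?thesis
    using assms(1) unfolding free_ring_carrier free_act_def[abs_def] by blast
qed

lemma spin_add:
  assumes "alt_form m"
  shows "spin (p + q) m vs = spin p m vs + spin q m vs"
  using alt_form_linear[OF assms, of "[]" vs]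
  by (simp add: spin_def contract_def cup1_def dual_app_simps linear_iff algebra_simps sum.distrib)

definition clifford_annihilator ::
  "'a::real_vector torus \<Rightarrow> (('a \<times> 'a dual) list \<Rightarrow> int) set" where
  "clifford_annihilator A =
     {f \<in> carrier (free_ring (Lam A)). \<forall>m\<in>coh A. free_act f m = (\<lambda>_. 0)}"

lemma free_act_zero: "free_act f (\<lambda>_. 0) = (\<lambda>_. 0)"
proof -
  have "word_act w (\<lambda>_. 0) = (\<lambda>_. 0)" for w :: "('a \<times> 'a dual) list"
    using word_act_sum[where S = "{}"] by simp
  then show ?thesis by (simp add: free_act_def[abs_def])
qed

lemma ideal_clifford_annihilator: "ideal (clifford_annihilator A) (free_ring (Lam A))"
proof (rule idealI[OF ring_free_ring])
  let ?R = "free_ring (Lam A)"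
  interpret ring ?R by (rule ring_free_ring)
  show "subgroup (clifford_annihilator A) (add_monoid ?R)"
  proof (rule add.subgroupI)
    show "clifford_annihilator A \<subseteq> carrier ?R"
      by (auto simp: clifford_annihilator_def)
    have "(\<lambda>_. 0) \<in> clifford_annihilator A"
      by (simp add: clifford_annihilator_def free_ring_carrier free_act_def[abs_def])
    then show "clifford_annihilator A \<noteq> {}" by blast
  next
    fix f assume f: "f \<in> clifford_annihilator A"
    then have fc: "f \<in> carrier ?R" by (simp add: clifford_annihilator_def)
    have nc: "(\<lambda>w. - f w) \<in> carrier ?R"
      using fc by (simp add: free_ring_carrier)
    have "\<ominus>\<^bsub>?R\<^esub> f = (\<lambda>w. - f w)"
      by (rule minus_equality) (simp_all add: free_ring_simps fc nc)
    moreover have "(\<lambda>w. - f w) \<in> clifford_annihilator A"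
      using f nc by (auto simp: clifford_annihilator_def free_act_def fun_eq_iff sum_negf)
    ultimately show "\<ominus>\<^bsub>?R\<^esub> f \<in> clifford_annihilator A" by simp
  next
    fix f g assume f: "f \<in> clifford_annihilator A" and g: "g \<in> clifford_annihilator A"
    then have fc: "f \<in> carrier ?R" "g \<in> carrier ?R"
      by (simp_all add: clifford_annihilator_def)
    have "free_act (\<lambda>w. f w + g w) m = (\<lambda>_. 0)" if "m \<in> coh A" for m
      using free_act_add[OF fc, of 1 m] f g that by (simp add: clifford_annihilator_def fun_eq_iff)
    then show "f \<oplus>\<^bsub>?R\<^esub> g \<in> clifford_annihilator A"
      using a_closed[OF fc] by (simp add: clifford_annihilator_def free_ring_simps)
  qed
next
  let ?R = "free_ring (Lam A)"
  interpret ring ?R by (rule ring_free_ring)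
  fix f g assume f: "f \<in> clifford_annihilator A" and g: "g \<in> carrier ?R"
  have fc: "f \<in> carrier ?R" using f by (simp add: clifford_annihilator_def)
  show "g \<otimes>\<^bsub>?R\<^esub> f \<in> clifford_annihilator A" "f \<otimes>\<^bsub>?R\<^esub> g \<in> clifford_annihilator A"
    using f m_closed[OF g fc] m_closed[OF fc g]
    by (simp_all add: clifford_annihilator_def free_act_mult[OF g fc] free_act_mult[OF fc g]
        free_act_zero free_act_coh[OF g])
qed

lemma free_act_minus:
  assumes "f \<in> carrier (free_ring X)" "g \<in> carrier (free_ring X)"
  shows "free_act (\<lambda>w. f w - g w) m vs = free_act f m vs - free_act g m vs"
  using free_act_add[OF assms, of "-1" m vs] by simp

lemma lattice_add:
  assumes "is_lattice G" "x \<in> G" "y \<in> G"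
  shows "x + y \<in> G"
proof -
  obtain B where G: "G = range (\<lambda>k :: 'a \<Rightarrow> int. \<Sum>b\<in>B. of_int (k b) *\<^sub>R b)"
    using assms(1) by (auto simp: is_lattice_def)
  obtain k l where "x = (\<Sum>b\<in>B. of_int (k b) *\<^sub>R b)" "y = (\<Sum>b\<in>B. of_int (l b) *\<^sub>R b)"
    using assms(2,3) unfolding G by blast
  then have "x + y = (\<Sum>b\<in>B. of_int (k b + l b) *\<^sub>R b)"
    by (simp add: sum.distrib scaleR_add_left)
  then show ?thesis unfolding G by (rule range_eqI[where x = "\<lambda>b. k b + l b"])
qed

lemma Lam_add: "complex_torus A \<Longrightarrow> p \<in> Lam A \<Longrightarrow> q \<in> Lam A \<Longrightarrow> p + q \<in> Lam A"
  by (auto simp: Lam_def complex_torus_def dual_torus_def lattice_add dual_app_simps)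

lemma relations_annihilate:
  assumes "complex_torus A"
  shows "tensor_relations (Lam A) \<union> square_relations (Lam A) Qform \<subseteq> clifford_annihilator A"
proof
  let ?R = "free_ring (Lam A)"
  fix f assume "f \<in> tensor_relations (Lam A) \<union> square_relations (Lam A) Qform"
  then consider (T) p q where "p \<in> Lam A" "q \<in> Lam A"
      "f = (\<lambda>w. word [p + q] w - word [p] w - word [q] w)"
    | (S) p k where "p \<in> Lam A" "of_int k = Qform p p / 2"
      "f = (\<lambda>w. word [p, p] w - k * word [] w)"
    by (auto simp: tensor_relations_def square_relations_def)
  then show "f \<in> clifford_annihilator A"
  proof cases
    case T
    have c: "word [p + q] \<in> carrier ?R" "word [p] \<in> carrier ?R" "word [q] \<in> carrier ?R"
      using T Lam_add[OF assms T(1,2)] by (simp_all add: word_carrier)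
    have d: "(\<lambda>w. word [p + q] w - word [p] w) \<in> carrier ?R"
      using free_ring_add_closed[OF c(1,2), of "-1"] by simp
    have "f \<in> carrier ?R"
      using free_ring_add_closed[OF d c(3), of "-1"] T(3) by simp
    moreover have "free_act f m vs = 0" if "m \<in> coh A" for m vs
    proof -
      have "alt_form m" using that by (simp add: coh_def)
      then show ?thesis
        unfolding T(3) free_act_minus[OF d c(3)] free_act_minus[OF c(1,2)] free_act_word
        by (simp add: word_act_def spin_add)
    qed
    ultimately show ?thesis by (auto simp: clifford_annihilator_def)
  next
    case S
    have c: "word [p, p] \<in> carrier ?R" "word [] \<in> carrier ?R"
      using S by (auto intro!: word_carrier)
    have f: "f = (\<lambda>w. word [p, p] w + (- k) * word [] w)"
      using S(3) by simp
    have "f \<in> carrier ?R"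
      unfolding f by (rule free_ring_add_closed[OF c])
    moreover have "free_act f m vs = 0" if "m \<in> coh A" for m vs
    proof -
      have "alt_form m" using that by (simp add: coh_def)
      then show ?thesis
        unfolding f free_act_add[OF c] free_act_word
        using S(2) by (simp add: word_act_def spin_spin)
    qed
    ultimately show ?thesis by (auto simp: clifford_annihilator_def)
  qed
qed

lemma clifford_ideal_annihilates:
  "complex_torus A \<Longrightarrow> clifford_ideal (Lam A) Qform \<subseteq> clifford_annihilator A"
  unfolding clifford_ideal_def
  by (rule ring.genideal_minimal[OF ring_free_ring ideal_clifford_annihilator relations_annihilate])

lemma clifford_act_class:
  assumes "complex_torus A" "f \<in> carrier (free_ring (Lam A))" "m \<in> coh A"
  shows "clifford_act (clifford_class (Lam A) Qform f) m = free_act f m"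
proof -
  let ?R = "free_ring (Lam A)"
  interpret ring ?R by (rule ring_free_ring)
  have I: "h \<in> carrier ?R" "free_act h m = (\<lambda>_. 0)" if "h \<in> clifford_ideal (Lam A) Qform" for h
    using clifford_ideal_annihilates[OF assms(1)] that assms(3)
    by (auto simp: clifford_annihilator_def)
  have cls: "clifford_class (Lam A) Qform f = {\<lambda>w. h w + f w | h. h \<in> clifford_ideal (Lam A) Qform}"
    by (auto simp: clifford_class_def a_r_coset_def r_coset_def free_ring_simps)
  have eq: "free_act g m = free_act f m" if g: "g \<in> clifford_class (Lam A) Qform f" for g
  proof -
    obtain h where h: "h \<in> clifford_ideal (Lam A) Qform" "g = (\<lambda>w. h w + f w)"
      using g unfolding cls by blast
    have "free_act (\<lambda>w. h w + 1 * f w) m vs = free_act f m vs" for vs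
      unfolding free_act_add[OF I(1)[OF h(1)] assms(2)] I(2)[OF h(1)] by simp
    then show ?thesis
      unfolding h(2) by (simp add: fun_eq_iff)
  qed
  have "clifford_annihilator A \<subseteq> carrier ?R"
    unfolding clifford_annihilator_def by blast
  then have "ideal (clifford_ideal (Lam A) Qform) ?R"
    unfolding clifford_ideal_def
    by (intro genideal_ideal order_trans[OF relations_annihilate[OF assms(1)]])
  then have "\<zero>\<^bsub>?R\<^esub> \<in> clifford_ideal (Lam A) Qform"
    by (intro additive_subgroup.zero_closed ideal.axioms(1))
  then have "(\<lambda>w. \<zero>\<^bsub>?R\<^esub> w + f w) \<in> clifford_class (Lam A) Qform f"
    unfolding cls by blast
  then have "f \<in> clifford_class (Lam A) Qform f"
    by (simp add: free_ring_simps)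
  then show ?thesis
    unfolding clifford_act_def using eq by (intro the_equality) blast+
qed

lemma clifford_act_gen:
  assumes "complex_torus A" "p \<in> Lam A" "m \<in> coh A"
  shows "clifford_act (clifford_gen (Lam A) Qform p) m = spin p m"
  using clifford_act_class[OF assms(1) word_carrier assms(3), of "[p]"] assms(2)
  by (simp add: free_act_word word_act_def)


end

theory Submission
  imports Defs
begin

text \<open>
  The parity of \<open>\<beta>\<close> is decided by one spinor. The class \<open>1 \<in> H\<^sup>0(A)\<close> is annihilated by contraction
  with every vector of \<open>V\<^sub>A\<close>, so its image under \<open>\<beta>\<close> is annihilated by the isotropic subspace
  \<open>L = \<alpha>(V\<^sub>A)\<close> of \<open>V\<^sub>B \<oplus> V\<^sub>B\<^sup>*\<close>. Since \<open>V\<^sub>A\<close> is stable under the complex structure of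
  \<open>A\<close> times its dual, the subspace \<open>L\<close> is stable under \<open>I = I\<^bsub>\<omega>B\<^esub>\<close>. Such a spinor \<open>t\<close> has the parity of \<open>n\<close>,
  for the following reason (\<open>pure_spinor_parity\<close>).

  Complexify. The elements \<open>u - i I u\<close> form an isotropic subspace \<open>E\<close>, so they anticommute in the
  Clifford algebra. Choose a complex basis \<open>e\<^sub>1, \<dots>, e\<^sub>n\<close> of \<open>V\<^sub>A\<close> with dual covectors
  \<open>x\<^sub>1, \<dots>, x\<^sub>n\<close> and multiply \<open>t\<close> by the \<open>n\<close> elements of \<open>E\<close> coming from \<open>\<alpha>(x\<^sub>1), \<dots>, \<alpha>(x\<^sub>n)\<close>.
  (On \<open>A\<close> this turns the class \<open>1\<close> into the volume form
  \<open>\<theta>\<^sub>1 \<and> \<dots> \<and> \<theta>\<^sub>n\<close> of degree \<open>n\<close>, where \<open>\<theta>\<^sub>j = x\<^sub>j + i x\<^sub>j \<circ> J\<close>.) The result \<open>W\<close> is annihilated by all of \<open>E\<close>, and it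
  vanishes only if \<open>t\<close> does, because the elements of the conjugate of \<open>E\<close> coming from the \<open>e\<^sub>j\<close>
  undo the multiplications one by one. On the other hand, since the imaginary part of \<open>\<omega>\<^sub>B\<close> is
  nondegenerate, \<open>E\<close> is the graph of a map from \<open>V\<^sub>B\<close> to covectors. To be annihilated by \<open>E\<close>
  therefore means that contracting \<open>W\<close> with a vector is the same as multiplying \<open>W\<close> by a
  covector. This expresses the components of degree \<open>k + 1\<close> by those of degree \<open>k - 1\<close> and makes the
  component of degree one vanish, so \<open>W\<close> is even (a multiple of the exponential of a
  \<open>2\<close>-form). A spinor \<open>t\<close> that is homogeneous of the wrong parity gives an odd \<open>W\<close>, hence \<open>W = 0\<close>
  and \<open>t = 0\<close>.

  The parity spreads from degree zero to all of \<open>H\<^sup>*(A)\<close> by induction on the degree: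
  contraction with a basis of the lattice lowers the degree, and contracting and then multiplying
  by the dual basis is multiplication by the degree (\<open>euler_identity\<close>,
  \<open>parity_of_spinor_iso\<close>). So \<open>\<beta>\<close> shifts parity by \<open>n\<close>, and a bijection that does so is even or odd
  according to the parity of \<open>n\<close> (\<open>parity_of_graded_iso\<close>).
\<close>

section \<open>Bases and complex bases\<close>

definition finite_basis :: "'a::real_vector set \<Rightarrow> bool" where
  "finite_basis B \<longleftrightarrow> finite B \<and> independent B \<and> span B = UNIV"

lemma finite_basis_dim: "finite_basis B \<Longrightarrow> dim (UNIV :: 'a set) = card (B :: 'a::real_vector set)"
  using dim_eq_card[of B UNIV] by (simp add: finite_basis_def)

lemma coordinate_functionals:
  assumes "finite_basis (B :: 'a::real_vector set)"
  obtains x where "\<forall>b\<in>B. \<forall>c\<in>B. dual_app (x b) c = (if b = c then 1 else 0)"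
    and "\<forall>v. v = (\<Sum>b\<in>B. dual_app (x b) v *\<^sub>R b)"
proof -
  have B: "finite B" "independent B" "span B = UNIV"
    using assms by (auto simp: finite_basis_def)
  have "\<exists>f. linear f \<and> (\<forall>c\<in>B. f c = (if b = c then 1 else (0::real)))" for b
    by (rule linear_independent_extend[OF B(2)])
  then obtain f where f: "\<And>b. linear (f b)"
    "\<And>b c. c \<in> B \<Longrightarrow> f b c = (if b = c then 1 else (0::real))" by metis
  define x where "x b = Dual (f b)" for b
  have x: "dual_app (x b) = f b" for b
    by (simp add: x_def dual_app_Dual f)
  have "v = (\<Sum>b\<in>B. dual_app (x b) v *\<^sub>R b)" for v
  proof (rule linear_eq_on[of "\<lambda>v. v" "\<lambda>v. \<Sum>b\<in>B. dual_app (x b) v *\<^sub>R b" v B])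
    show "linear (\<lambda>v. \<Sum>b\<in>B. dual_app (x b) v *\<^sub>R b)"
      using f(1) by (intro linear_compose_sum ballI)
        (simp add: x linear_iff algebra_simps)
    show "c = (\<Sum>b\<in>B. dual_app (x b) c *\<^sub>R b)" if "c \<in> B" for c
      using that B(1) by (simp add: x f if_distrib[of "\<lambda>r. r *\<^sub>R _"] cong: if_cong)
  qed (use B in \<open>simp_all add: linear_iff\<close>)
  then show thesis by (intro that[of x] ballI allI) (simp_all only: x f)
qed

text \<open>
  A maximal set \<open>E\<close> for which \<open>E \<union> J E\<close> is independent does the job: its span is stable under \<open>J\<close>, and for
  a vector \<open>e\<close> outside, \<open>J e\<close> cannot depend on \<open>e\<close> modulo that span, because a real eigenvalue \<open>k\<close> of
  \<open>J\<close> would satisfy \<open>k\<^sup>2 = -1\<close>.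
\<close>

lemma complex_basis:
  fixes J :: "'a::real_vector \<Rightarrow> 'a"
  assumes B: "finite_basis (B :: 'a set)"
    and J: "linear J" "\<And>v. J (J v) = - v"
  obtains E where "finite_basis (E \<union> J ` E)" "E \<inter> J ` E = {}" "2 * card E = dim (UNIV :: 'a set)"
proof -
  let ?P = "\<lambda>E :: 'a set. independent (E \<union> J ` E) \<and> E \<inter> J ` E = {}"
  have B': "finite B" "span B = UNIV"
    using B by (auto simp: finite_basis_def)
  have injJ: "inj J"
    by (rule injI) (metis J(2) neg_equal_iff_equal)
  have bound: "finite F \<and> card F \<le> card B" if "independent F" for F :: "'a set"
    using independent_span_bound[OF B'(1) that] B'(2) by simp
  have card2: "finite E \<and> card (E \<union> J ` E) = 2 * card E" if "?P E" for E
  proof -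
    have "finite E" using bound[of "E \<union> J ` E"] that by simp
    then show ?thesis
      using that injJ by (simp add: card_Un_disjoint card_image inj_on_subset)
  qed
  have "?P {}" by (simp add: independent_empty)
  moreover have "\<forall>E. ?P E \<longrightarrow> card E < Suc (card B)"
  proof (intro allI impI)
    fix E assume "?P E"
    then show "card E < Suc (card B)" using card2[of E] bound[of "E \<union> J ` E"] by simp
  qed
  ultimately have "\<exists>E. ?P E \<and> (\<forall>E'. ?P E' \<longrightarrow> card E' \<le> card E)"
    by (rule ex_has_greatest_nat[of ?P "{}" card "Suc (card B)"])
  then obtain E where Emax: "?P E \<and> (\<forall>E'. ?P E' \<longrightarrow> card E' \<le> card E)"
    by (rule exE)
  then have E: "?P E" and max: "?P E' \<Longrightarrow> card E' \<le> card E" for E'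
    by simp_all
  let ?F = "E \<union> J ` E"
  have finE: "finite E" using card2[OF E] by simp
  have J_span: "J v \<in> span ?F" if "v \<in> span ?F" for v
    using that
  proof (induction rule: span_induct)
    case base
    show ?case
      using J(1) by (auto simp: linear_iff subspace_def linear_0 intro: span_add span_mul span_zero)
  next
    case (step v)
    have "- x \<in> span ?F" if "x \<in> E" for x
      using that by (intro span_neg span_base) simp
    then show ?case using step by (auto simp: J(2) intro: span_base)
  qed
  have "e \<in> span ?F" for e
  proof (rule ccontr)
    assume e: "e \<notin> span ?F"
    \<comment> \<open>If \<open>J e - k e\<close> lay in the span, applying \<open>J\<close> and eliminating \<open>J e\<close> would put
      \<open>(- 1 - k * k) e\<close> there.\<close>
    have Je: "J e \<notin> span (insert e ?F)"
    proof
      assume "J e \<in> span (insert e ?F)"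
      then obtain k where k: "J e - k *\<^sub>R e \<in> span ?F"
        by (auto simp: span_breakdown_eq)
      from J_span[OF this] have "- e - k *\<^sub>R J e \<in> span ?F"
        using J by (simp add: linear_diff linear_scale)
      from span_add[OF this span_scale[OF k, of k]]
      have "(- 1 - k * k) *\<^sub>R e \<in> span ?F" by (simp add: algebra_simps)
      moreover have "- 1 - k * k \<noteq> 0"
        using zero_le_square[of k] by linarith
      ultimately show False
        using e span_scale[of "(- 1 - k * k) *\<^sub>R e" ?F "inverse (- 1 - k * k)"] by simp
    qed
    have ind: "independent (insert (J e) (insert e ?F))"
      using E e Je by (intro independent_insertI) auto
    have "e \<notin> E" "e \<notin> J ` E" using e span_base[of e ?F] by auto
    moreover have "J e \<notin> E" "J e \<noteq> e" using Je span_base[of "J e" "insert e ?F"] by auto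
    moreover have "J e \<notin> J ` E" using \<open>e \<notin> E\<close> injJ by (auto dest: injD)
    ultimately have "?P (insert e E)"
      using ind E by (auto simp: insert_commute)
    from max[OF this] show False using \<open>e \<notin> E\<close> finE by simp
  qed
  then have "finite_basis ?F"
    using E finE by (auto simp: finite_basis_def)
  then show thesis
    using E card2[OF E] finite_basis_dim[of ?F] by (intro that) simp_all
qed

text \<open>
  The functionals are the coordinates of \<open>e\<close> in the real basis \<open>E \<union> J E\<close>; the coordinate of \<open>J e\<close> is
  \<open>- x e \<circ> J\<close>, which is why one functional per complex basis vector is enough.
\<close>

lemma complex_dual_basis:
  fixes J :: "'a::real_vector \<Rightarrow> 'a"
  assumes B: "finite_basis (B :: 'a set)"
    and J: "linear J" "\<And>v. J (J v) = - v"
  obtains E x where "finite (E :: 'a set)" "2 * card E = dim (UNIV :: 'a set)"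
    "\<forall>e\<in>E. \<forall>e'\<in>E. dual_app (x e) e' = (if e = e' then 1 else 0)"
    "\<forall>e\<in>E. \<forall>e'\<in>E. dual_app (x e) (J e') = 0"
    "\<forall>v. v = (\<Sum>e\<in>E. dual_app (x e) v *\<^sub>R e - dual_app (x e) (J v) *\<^sub>R J e)"
proof -
  obtain E where E: "finite_basis (E \<union> J ` E)" "E \<inter> J ` E = {}" "2 * card E = dim (UNIV :: 'a set)"
    by (rule complex_basis[OF B J])
  obtain x where x: "\<forall>b\<in>E \<union> J ` E. \<forall>c\<in>E \<union> J ` E. dual_app (x b) c = (if b = c then 1 else 0)"
    and "\<forall>v. v = (\<Sum>b\<in>E \<union> J ` E. dual_app (x b) v *\<^sub>R b)"
    by (rule coordinate_functionals[OF E(1)])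
  have finE: "finite E" using E(1) by (simp add: finite_basis_def)
  have x1: "dual_app (x e) e' = (if e = e' then 1 else 0)" if "e \<in> E" "e' \<in> E" for e e'
    using x that by simp
  have x2: "dual_app (x e) (J e') = 0" if "e \<in> E" "e' \<in> E" for e e'
    using x that E(2) by auto
  have "v = (\<Sum>e\<in>E. dual_app (x e) v *\<^sub>R e - dual_app (x e) (J v) *\<^sub>R J e)" for v
  proof (rule linear_eq_on[of "\<lambda>v. v" _ v "E \<union> J ` E"])
    show "linear (\<lambda>v. \<Sum>e\<in>E. dual_app (x e) v *\<^sub>R e - dual_app (x e) (J v) *\<^sub>R J e)"
      using linear_dual_app[of "x _"] J(1)
      by (intro linear_compose_sum ballI) (simp add: linear_iff algebra_simps)
    show "c = (\<Sum>e\<in>E. dual_app (x e) c *\<^sub>R e - dual_app (x e) (J c) *\<^sub>R J e)"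
      if "c \<in> E \<union> J ` E" for c
    proof -
      have d: "(if e = f then 1 else 0 :: real) *\<^sub>R u = (if e = f then u else 0)" for e f u :: 'a
        by auto
      have n: "dual_app y (- u) = - dual_app y u" for y :: "'a dual" and u
        using linear_dual_app[of y] by (simp add: linear_neg)
      from that show ?thesis
        using finE by (auto simp: x1 x2 d n J(2))
    qed
  qed (use E in \<open>simp_all add: linear_iff finite_basis_def\<close>)
  then show thesis
    using x1 x2 by (intro that[of E x, OF finE E(3)] ballI allI) assumption+
qed

section \<open>The doubled lattice and its real span\<close>

lemma linear_dual_app_left: "linear (\<lambda>y. dual_app y v)"
  by (simp add: linear_iff dual_app_simps)

lemma dual_app_sum: "dual_app (\<Sum>i\<in>S. f i) v = (\<Sum>i\<in>S. dual_app (f i) v)"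
  by (rule linear_sum[OF linear_dual_app_left])

lemma lattice_zero: "is_lattice G \<Longrightarrow> 0 \<in> G"
  by (auto simp: is_lattice_def intro!: range_eqI[where x = "\<lambda>_. 0"])

text \<open>
  An integral basis together with its dual basis. Both lie in the doubled lattice, so the
  lattice hypotheses on \<open>\<alpha>\<close> and \<open>\<beta>\<close> can be applied to them.
\<close>

lemma lattice_basis:
  assumes "complex_torus A"
  obtains B x where "finite_basis B" "\<forall>b\<in>B. (b, 0) \<in> Lam A \<and> (0, x b) \<in> Lam A"
    "\<forall>v. v = (\<Sum>b\<in>B. dual_app (x b) v *\<^sub>R b)"
proof -
  obtain B where B: "finite B" "independent B" "span B = UNIV"
    and G: "lat A = range (\<lambda>k :: 'a \<Rightarrow> int. \<Sum>b\<in>B. of_int (k b) *\<^sub>R b)"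
    using assms by (auto simp: complex_torus_def is_lattice_def)
  have fb: "finite_basis B" using B by (simp add: finite_basis_def)
  obtain x where x: "\<forall>b\<in>B. \<forall>c\<in>B. dual_app (x b) c = (if b = c then 1 else 0)"
    and ex: "\<forall>v. v = (\<Sum>b\<in>B. dual_app (x b) v *\<^sub>R b)"
    by (rule coordinate_functionals[OF fb])
  have "b \<in> lat A" if b: "b \<in> B" for b
  proof -
    have "(\<Sum>c\<in>B. of_int (if c = b then 1 else 0) *\<^sub>R c) = (\<Sum>c\<in>B. if c = b then c else 0)"
      by (rule sum.cong) auto
    then have "b = (\<Sum>c\<in>B. of_int (if c = b then 1 else 0) *\<^sub>R c)"
      using b B(1) by simp
    then show ?thesis
      unfolding G by (rule range_eqI[where x = "\<lambda>c. if c = b then 1 else 0"])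
  qed
  moreover have "x b \<in> lat (dual_torus A)" if b: "b \<in> B" for b
  proof -
    have "dual_app (x b) (\<Sum>c\<in>B. of_int (k c) *\<^sub>R c) = of_int (k b)" for k :: "'a \<Rightarrow> int"
    proof -
      have "dual_app (x b) (\<Sum>c\<in>B. of_int (k c) *\<^sub>R c) = (\<Sum>c\<in>B. of_int (k c) * dual_app (x b) c)"
        using linear_dual_app[of "x b"] by (simp add: linear_sum linear_scale)
      also have "\<dots> = (\<Sum>c\<in>B. if c = b then of_int (k c) else 0)"
        by (rule sum.cong) (use x b in auto)
      finally show ?thesis using b B(1) by simp
    qed
    then show ?thesis by (auto simp: dual_torus_def G)
  qed
  moreover have "0 \<in> lat A" "0 \<in> lat (dual_torus A)"
    using assms by (auto simp: complex_torus_def lattice_zero dual_torus_def dual_app_simps)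
  ultimately show thesis
    by (intro that[OF fb _ ex]) (simp add: Lam_def)
qed

lemma span_lat:
  assumes "complex_torus A"
  shows "span (lat A) = UNIV"
proof -
  obtain B x where B: "finite_basis B" "\<forall>b\<in>B. (b, 0) \<in> Lam A \<and> (0, x b) \<in> Lam A"
    by (rule lattice_basis[OF assms])
  then have "B \<subseteq> lat A" by (auto simp: Lam_def)
  then show ?thesis
    using span_mono[of B "lat A"] B(1) by (auto simp: finite_basis_def)
qed

lemma span_Lam:
  assumes "complex_torus A"
  shows "span (Lam A) = UNIV"
proof -
  obtain B x where L: "\<forall>b\<in>B. (b, 0) \<in> Lam A \<and> (0, x b) \<in> Lam A"
    and ex: "\<forall>v. v = (\<Sum>b\<in>B. dual_app (x b) v *\<^sub>R b)"
    by (rule lattice_basis[OF assms])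
  have "(v, y) \<in> span (Lam A)" for v y
  proof -
    have "y = (\<Sum>b\<in>B. dual_app y b *\<^sub>R x b)"
    proof (rule dual_eqI)
      fix v
      have "dual_app y v = dual_app y (\<Sum>b\<in>B. dual_app (x b) v *\<^sub>R b)"
        using ex by metis
      also have "\<dots> = (\<Sum>b\<in>B. dual_app (x b) v * dual_app y b)"
        using linear_dual_app[of y] by (simp add: linear_sum linear_scale)
      finally show "dual_app y v = dual_app (\<Sum>b\<in>B. dual_app y b *\<^sub>R x b) v"
        by (simp add: dual_app_sum dual_app_simps mult.commute)
    qed
    then have "(v, y) = (\<Sum>b\<in>B. dual_app (x b) v *\<^sub>R (b, 0)) + (\<Sum>b\<in>B. dual_app y b *\<^sub>R (0, x b))"
      using ex by (auto simp: prod_eq_iff fst_sum snd_sum)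
    moreover have "\<dots> \<in> span (Lam A)"
      using L by (intro span_add span_sum span_scale span_base) simp_all
    ultimately show ?thesis by simp
  qed
  then show ?thesis by auto
qed

lemma dual_app_cstr_dual:
  assumes "complex_torus A"
  shows "dual_app (cstr (dual_torus A) w) v = - dual_app w (cstr A v)"
proof -
  have neg: "dual_app w (- v) = - dual_app w v" for v
    using linear_dual_app[of w] by (simp add: linear_neg)
  have "linear (\<lambda>v. dual_app w (- cstr A v))"
    using linear_dual_app[of w] assms by (simp add: complex_torus_def linear_iff neg)
  then show ?thesis
    by (simp add: dual_torus_def dual_app_Dual neg)
qed

lemma J_prod_props:
  assumes "complex_torus A"
  shows "linear (J_prod A)" and "J_prod A (J_prod A p) = - p"
    and "Qform (J_prod A p) (J_prod A q) = Qform p q"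
proof -
  have J: "linear (cstr A)" "\<And>v. cstr A (cstr A v) = - v"
    using assms by (simp_all add: complex_torus_def)
  have n: "dual_app y (- v) = - dual_app y v" for y :: "'a dual" and v
    using linear_dual_app[of y] by (simp add: linear_neg)
  have d: "cstr (dual_torus A) (y + z) = cstr (dual_torus A) y + cstr (dual_torus A) z"
    "cstr (dual_torus A) (r *\<^sub>R y) = r *\<^sub>R cstr (dual_torus A) y"
    "cstr (dual_torus A) (cstr (dual_torus A) y) = - y" for y z r
    by (rule dual_eqI, simp add: dual_app_cstr_dual[OF assms] dual_app_simps J n)+
  show "linear (J_prod A)"
    using J(1) d(1,2) by (simp add: linear_iff J_prod_def)
  show "J_prod A (J_prod A p) = - p"
    by (simp add: J_prod_def prod_eq_iff J d)
  show "Qform (J_prod A p) (J_prod A q) = Qform p q"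
    by (simp add: J_prod_def Qform_def dual_app_cstr_dual[OF assms] J n)
qed

lemma Qform_add:
  "Qform (p + p') q = Qform p q + Qform p' q" "Qform q (p + p') = Qform q p + Qform q p'"
  using linear_dual_app[of "snd q"] by (simp_all add: Qform_def dual_app_simps linear_iff)

lemma linear_Qform: "linear (\<lambda>p. Qform p q)" "linear (Qform q)"
  using linear_dual_app[of "snd q"]
  by (simp_all add: Qform_def dual_app_simps linear_iff algebra_simps)

lemma Qform_commute: "Qform p q = Qform q p"
  by (simp add: Qform_def)

text \<open>
  Both properties extend from the lattice by linearity, since the lattice spans.
\<close>

lemma lattice_isometry_extension:
  assumes A: "complex_torus A" and B: "complex_torus B" and iso: "lattice_isometry A B \<alpha>"
    and a: "linear a" "\<forall>p\<in>Lam A. a p = \<alpha> p"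
  shows "surj a" and "Qform (a p) (a q) = Qform p q"
proof -
  have "a ` Lam A = Lam B"
    using iso a(2) by (auto simp: lattice_isometry_def bij_betw_def)
  then have "range a = span (Lam B)"
    using linear_span_image[OF a(1), of "Lam A"] span_Lam[OF A] by simp
  then show "surj a" using span_Lam[OF B] by simp
  have Q: "Qform (a p) (a q) = Qform p q" if "p \<in> Lam A" "q \<in> Lam A" for p q
    using that iso a(2) by (simp add: lattice_isometry_def)
  have Q1: "Qform (a p) (a q) = Qform p q" if q: "q \<in> Lam A" for p q
  proof (rule linear_eq_on[of "\<lambda>p. Qform (a p) (a q)" "\<lambda>p. Qform p q" p "Lam A"])
    show "linear (\<lambda>p. Qform (a p) (a q))"
      using linear_compose[OF a(1) linear_Qform(1)] by (simp add: o_def)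
  qed (use span_Lam[OF A] Q q linear_Qform(1)[of q] in simp_all)
  show "Qform (a p) (a q) = Qform p q"
  proof (rule linear_eq_on[of "\<lambda>q. Qform (a p) (a q)" "\<lambda>q. Qform p q" q "Lam A"])
    show "linear (\<lambda>q. Qform (a p) (a q))"
      using linear_compose[OF a(1) linear_Qform(2)] by (simp add: o_def)
  qed (use span_Lam[OF A] Q1 linear_Qform(2)[of p] in simp_all)
qed

section \<open>Parity of forms and the real Clifford action\<close>

text \<open>
  Only the parity of \<open>k\<close> matters; keeping a natural number makes the bookkeeping of degree shifts
  additive.
\<close>

definition has_parity :: "nat \<Rightarrow> ('v list \<Rightarrow> 'c::zero) \<Rightarrow> bool" where
  "has_parity k m \<longleftrightarrow> (\<forall>vs. odd (length vs + k) \<longrightarrow> m vs = 0)"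

definition parity_part :: "nat \<Rightarrow> ('v list \<Rightarrow> 'c::zero) \<Rightarrow> 'v list \<Rightarrow> 'c" where
  "parity_part k m vs = (if even (length vs + k) then m vs else 0)"

lemma has_parity_parity_part: "has_parity k (parity_part k m)"
  by (simp add: has_parity_def parity_part_def)

lemma has_parity_cong: "even (k + l) \<Longrightarrow> has_parity k m \<longleftrightarrow> has_parity l m"
  by (auto simp: has_parity_def)

lemma has_parity_both: "has_parity k m \<Longrightarrow> has_parity (Suc k) m \<Longrightarrow> m = (\<lambda>_. 0)"
  by (auto simp: has_parity_def fun_eq_iff)

lemma spin_lin:
  "spin p (\<lambda>vs. a * m vs + b * m' vs) vs = a * spin p m vs + b * spin p m' vs"
  by (simp add: spin_def cup1_lin contract_def algebra_simps)

text \<open>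
  Alternating forms are linear in their first argument, which makes the contraction part of the
  action linear in the vector.
\<close>

lemma linear_spin:
  assumes "alt_form m"
  shows "linear (\<lambda>p. spin p m vs)"
proof (rule linearI)
  show "spin (p + q) m vs = spin p m vs + spin q m vs" for p q
    by (rule spin_add[OF assms])
  show "spin (r *\<^sub>R p) m vs = r *\<^sub>R spin p m vs" for r p
    using alt_form_linear[OF assms, of "[]" vs]
    by (simp add: spin_def contract_def cup1_def dual_app_simps linear_iff algebra_simps
        sum_distrib_left)
qed

lemma alt_form_spin:
  assumes "alt_form m"
  shows "alt_form (spin p m)"
proof -
  have "spin p m = (\<lambda>vs. 1 * contract (fst p) m vs + 1 * cup1 (snd p) m vs)"
    by (rule ext) (simp add: spin_def)
  then show ?thesis
    by (simp only: alt_form_lin[OF alt_form_contract alt_form_cup1, OF assms assms])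
qed

lemma spin_zero: "spin p (\<lambda>_. 0) = (\<lambda>_. 0)"
  by (rule ext) (simp add: spin_def contract_def cup1_def)

text \<open>
  The polarisation of the Clifford relation.
\<close>

lemma spin_anticommutator:
  assumes "alt_form m"
  shows "spin p (spin q m) vs + spin q (spin p m) vs = Qform p q * m vs"
proof -
  have sum: "spin (p + q) m = (\<lambda>vs. 1 * spin p m vs + 1 * spin q m vs)"
    by (rule ext) (simp add: spin_add[OF assms])
  have "spin (p + q) (spin (p + q) m) vs = spin p (spin (p + q) m) vs + spin q (spin (p + q) m) vs"
    by (rule spin_add[OF alt_form_spin[OF assms]])
  also have "\<dots> = spin p (spin p m) vs + spin p (spin q m) vs
      + (spin q (spin p m) vs + spin q (spin q m) vs)"
    unfolding sum spin_lin by simp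
  finally have "spin (p + q) (spin (p + q) m) vs = \<dots>" .
  then show ?thesis
    by (simp add: spin_spin[OF assms] Qform_add Qform_commute[of q p] field_simps)
qed

lemma has_parity_spin: "has_parity k m \<Longrightarrow> has_parity (Suc k) (spin p m)"
  by (auto simp: has_parity_def spin_def contract_def cup1_def intro!: sum.neutral)

lemma spin_parity_part: "spin p (parity_part k m) = parity_part (Suc k) (spin p m)"
  by (rule ext) (auto simp: parity_part_def spin_def contract_def cup1_def intro!: sum.neutral)

lemma alt_form_parity_part: "alt_form m \<Longrightarrow> alt_form (parity_part k m)"
  by (auto simp: alt_form_def parity_part_def linear_iff)

lemma parity_part_coh: "m \<in> coh A \<Longrightarrow> parity_part k m \<in> coh A"
  by (auto simp: coh_def alt_form_parity_part) (simp add: parity_part_def)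

section \<open>The complexified Clifford action\<close>

definition calt_form :: "('b::real_vector list \<Rightarrow> complex) \<Rightarrow> bool" where
  "calt_form M \<longleftrightarrow> alt_form (\<lambda>vs. Re (M vs)) \<and> alt_form (\<lambda>vs. Im (M vs))"

text \<open>
  A pair \<open>(p, q)\<close> stands for the element \<open>p + i q\<close> of the complexified space, and a complex valued
  function for the form \<open>X + i Y\<close> with real forms \<open>X\<close> and \<open>Y\<close>; the right-hand side is
  \<open>(p X - q Y) + i (p Y + q X)\<close>.
\<close>

definition cspin :: "('b::real_vector \<times> 'b dual) \<times> ('b \<times> 'b dual) \<Rightarrow>
    ('b list \<Rightarrow> complex) \<Rightarrow> 'b list \<Rightarrow> complex" where
  "cspin z M vs = Complex
     (spin (fst z) (\<lambda>vs. Re (M vs)) vs - spin (snd z) (\<lambda>vs. Im (M vs)) vs)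
     (spin (fst z) (\<lambda>vs. Im (M vs)) vs + spin (snd z) (\<lambda>vs. Re (M vs)) vs)"

text \<open>
  The complex bilinear (not hermitian) extension of \<open>Qform\<close>.
\<close>

definition cQform :: "('b::real_vector \<times> 'b dual) \<times> ('b \<times> 'b dual) \<Rightarrow>
    ('b \<times> 'b dual) \<times> ('b \<times> 'b dual) \<Rightarrow> complex" where
  "cQform z z' = Complex
     (Qform (fst z) (fst z') - Qform (snd z) (snd z'))
     (Qform (fst z) (snd z') + Qform (snd z) (fst z'))"

lemma alt_form_diff: "alt_form m \<Longrightarrow> alt_form m' \<Longrightarrow> alt_form (\<lambda>vs. m vs - m' vs)"
  using alt_form_lin[of m m' 1 "-1"] by simp

lemma alt_form_add: "alt_form m \<Longrightarrow> alt_form m' \<Longrightarrow> alt_form (\<lambda>vs. m vs + m' vs)"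
  using alt_form_lin[of m m' 1 1] by simp

lemma calt_form_cspin: "calt_form M \<Longrightarrow> calt_form (cspin z M)"
  by (simp add: calt_form_def cspin_def alt_form_diff alt_form_add alt_form_spin)

lemma cspin_anticommutator:
  assumes "calt_form M"
  shows "cspin z (cspin z' M) vs + cspin z' (cspin z M) vs = cQform z z' * M vs"
proof -
  have d: "spin p (\<lambda>vs. m vs - m' vs) vs = spin p m vs - spin p m' vs"
    and a: "spin p (\<lambda>vs. m vs + m' vs) vs = spin p m vs + spin p m' vs"
    for p :: "'a \<times> 'a dual" and m m'
    using spin_lin[of p 1 m "-1" m' vs] spin_lin[of p 1 m 1 m' vs] by simp_all
  define X Y where "X = (\<lambda>vs. Re (M vs))" and "Y = (\<lambda>vs. Im (M vs))"
  have XY: "alt_form X" "alt_form Y" using assms by (auto simp: calt_form_def X_def Y_def)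
  define p q p' q' where "p = fst z" "q = snd z" "p' = fst z'" "q' = snd z'"
  have c: "spin u (spin v X) vs = Qform u v * X vs - spin v (spin u X) vs"
    "spin u (spin v Y) vs = Qform u v * Y vs - spin v (spin u Y) vs" for u v
    using spin_anticommutator[OF XY(1), of u v vs] spin_anticommutator[OF XY(2), of u v vs]
    by simp_all
  have "M vs = Complex (X vs) (Y vs)" by (simp add: X_def Y_def)
  then show ?thesis
    unfolding cspin_def complex.sel X_def[symmetric] Y_def[symmetric] cQform_def d a
      p_q_p'_q'_def[symmetric]
    by (simp add: complex_eq_iff c[of p p'] c[of p q'] c[of q p'] c[of q q'] algebra_simps)
qed

lemma cspin_zero: "cspin z (\<lambda>_. 0) = (\<lambda>_. 0)"
  by (rule ext) (simp add: cspin_def spin_zero complex_eq_iff)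

lemma has_parity_cspin: "has_parity k M \<Longrightarrow> has_parity (Suc k) (cspin z M)"
proof -
  assume M: "has_parity k M"
  have "has_parity k (\<lambda>vs. Re (M vs))" "has_parity k (\<lambda>vs. Im (M vs))"
    using M by (auto simp: has_parity_def)
  from this[THEN has_parity_spin] show ?thesis
    by (simp add: has_parity_def cspin_def complex_eq_iff)
qed

definition cspins :: "(('b::real_vector \<times> 'b dual) \<times> ('b \<times> 'b dual)) list \<Rightarrow>
    ('b list \<Rightarrow> complex) \<Rightarrow> 'b list \<Rightarrow> complex" where
  "cspins zs M = foldr cspin zs M"

lemma calt_form_cspins: "calt_form M \<Longrightarrow> calt_form (cspins zs M)"
  by (induction zs) (simp_all add: cspins_def calt_form_cspin)

lemma has_parity_cspins: "has_parity k M \<Longrightarrow> has_parity (length zs + k) (cspins zs M)"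
  by (induction zs) (simp_all add: cspins_def has_parity_cspin)

text \<open>
  An annihilator of \<open>M\<close> can be moved to the right through elements orthogonal to it.
\<close>

lemma cspins_annihilated:
  assumes "calt_form M" "cspin z M = (\<lambda>_. 0)" "\<And>y. y \<in> set zs \<Longrightarrow> cQform z y = 0"
  shows "cspin z (cspins zs M) = (\<lambda>_. 0)"
  using assms(3)
proof (induction zs)
  case Nil
  show ?case by (simp add: cspins_def assms(2))
next
  case (Cons y zs)
  then have IH: "cspin z (cspins zs M) = (\<lambda>_. 0)" by simp
  show ?case
    using cspin_anticommutator[OF calt_form_cspins[OF assms(1)], of z y zs] Cons.prems[of y]
    by (simp add: IH cspin_zero) (simp add: cspins_def fun_eq_iff)
qed

text \<open>
  The factors anticommute and have square zero, so a repeated factor kills the product.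
\<close>

lemma cspins_member:
  assumes "calt_form M" "\<And>y y'. y \<in> set zs \<Longrightarrow> y' \<in> set zs \<Longrightarrow> cQform y y' = 0" "z \<in> set zs"
  shows "cspin z (cspins zs M) = (\<lambda>_. 0)"
  using assms(2,3)
proof (induction zs)
  case (Cons y zs)
  have c: "cspin z (cspin y (cspins zs M)) vs = - cspin y (cspin z (cspins zs M)) vs" for vs
    using cspin_anticommutator[OF calt_form_cspins[OF assms(1)], of z y zs vs] Cons.prems(1)[of z y] Cons.prems(2)
    by (simp add: eq_neg_iff_add_eq_0)
  show ?case
  proof (cases "z = y")
    case True
    then have "cspin z (cspin y (cspins zs M)) vs = 0" for vs
      using c[of vs] by simp
    then show ?thesis by (auto simp: cspins_def)
  next
    case False
    then have "cspin z (cspins zs M) = (\<lambda>_. 0)"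
      using Cons by simp
    then show ?thesis
      using c by (auto simp: cspins_def cspin_zero)
  qed
qed simp

section \<open>The parity of a pure spinor\<close>

lemma NS_real_bilinear: "c \<in> NS_real (A :: 'a::real_vector torus) \<Longrightarrow> bilinear c"
proof -
  assume "c \<in> NS_real A"
  then obtain S r where S: "S \<subseteq> NS A" "c = (\<lambda>u v. \<Sum>b\<in>S. r b * b u v)"
    by (auto simp: NS_real_def)
  have scale: "linear (\<lambda>x. r * h x)" if "linear h" for r and h :: "'a \<Rightarrow> real"
    using linear_compose_scale_right[OF that, of r] by simp
  have "bilinear b" if "b \<in> S" for b
    using S(1) that unfolding NS_def by blast
  then have "linear (b u)" "linear (\<lambda>u. b u v)" if "b \<in> S" for b u v
    using that by (simp_all add: bilinear_def)
  then show "bilinear c"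
    unfolding S(2) bilinear_def by (intro conjI allI linear_compose_sum ballI scale)
qed

text \<open>
  On covectors of the form \<open>\<phi>\<^sub>2 v\<close> the inverse of \<open>\<phi>\<^sub>2\<close> disappears from \<open>I\<^sub>\<omega>\<close>, which sends
  \<open>(0, \<phi>\<^sub>2 v)\<close> to \<open>(- v, - \<phi>\<^sub>1 v)\<close>. Hence \<open>u - i I\<^sub>\<omega> u\<close> for \<open>u = (0, \<phi>\<^sub>2 v)\<close> is
  \<open>i (v, \<phi>\<^sub>1 v - i \<phi>\<^sub>2 v)\<close>, a multiple of a point of the graph of \<open>\<phi>\<^sub>1 - i \<phi>\<^sub>2\<close>.
\<close>

lemma I_om_covector_graph:
  assumes "weak_pair B \<eta>"
  obtains f g where "\<forall>v. I_om \<eta> (0, g v) = (- v, - f v)"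
proof -
  obtain c1 c2 where c: "c1 \<in> NS_real B" "c2 \<in> NS_real0 B"
    and \<eta>: "\<eta> = (\<lambda>u v. complex_of_real (c1 u v) + \<i> * complex_of_real (c2 u v))"
    using assms by (auto simp: weak_pair_def NS_complex0_def)
  have bil: "bilinear c1" "bilinear c2"
    using c by (auto simp: NS_real0_def NS_real_bilinear)
  have zero: "form_hom c1 0 = 0" "form_hom c2 0 = 0"
  proof -
    have "c1 0 = (\<lambda>_. 0)" "c2 0 = (\<lambda>_. 0)"
      by (simp_all add: fun_eq_iff bilinear_lzero[OF bil(1)] bilinear_lzero[OF bil(2)])
    then show "form_hom c1 0 = 0" "form_hom c2 0 = 0"
      by (simp_all add: form_hom_def zero_dual_def)
  qed
  have "inj (form_hom c2)"
  proof (rule injI)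
    fix u v assume uv: "form_hom c2 u = form_hom c2 v"
    have l: "linear (c2 w)" for w using bil(2) by (simp add: bilinear_def)
    have "c2 u = c2 v"
      using arg_cong[OF uv, of dual_app] by (simp add: form_hom_def dual_app_Dual[OF l])
    then have "\<forall>w. c2 (u - v) w = 0"
      by (simp add: bilinear_lsub[OF bil(2)])
    then show "u = v" using c(2) by (auto simp: NS_real0_def)
  qed
  then have inv: "inv_into UNIV (form_hom c2) (form_hom c2 v) = v" for v
    by (rule inv_f_f)
  have "I_om \<eta> (0, form_hom c2 v) = (- v, - form_hom c1 v)" for v
    using inv[of v] inv[of 0] by (simp add: I_om_def \<eta> Let_def zero)
  then show thesis by (intro that allI)
qed

text \<open>
  The element \<open>(0, g v) + i (v, f v)\<close> is \<open>i\<close> times \<open>(v, f v - i g v)\<close>, so the hypothesis says that contracting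
  \<open>M\<close> with \<open>v\<close> equals multiplying \<open>M\<close> by the covector \<open>- f v + i g v\<close>. A value of \<open>M\<close> on a
  list of length \<open>k + 1\<close> thereby becomes a combination of values on lists of length \<open>k - 1\<close>, and the
  recursion ends with an empty sum in length one.
\<close>

lemma even_if_annihilated_by_graph:
  assumes M: "calt_form M"
    and ann: "\<And>v. cspin ((0, g v), (v, f v)) M = (\<lambda>_. 0)"
  shows "has_parity 0 M"
proof -
  define X Y where "X = (\<lambda>vs. Re (M vs))" and "Y = (\<lambda>vs. Im (M vs))"
  have XY: "alt_form X" "alt_form Y" using M by (auto simp: calt_form_def X_def Y_def)
  have zero: "X (0 # vs) = 0" "Y (0 # vs) = 0" for vs
    using linear_0[OF alt_form_linear[OF XY(1), of "[]" vs]]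
      linear_0[OF alt_form_linear[OF XY(2), of "[]" vs]] by simp_all
  have rec: "Y (v # vs) = cup1 (g v) X vs - cup1 (f v) Y vs"
    "X (v # vs) = - cup1 (g v) Y vs - cup1 (f v) X vs" for v vs
  proof -
    have "cspin ((0, g v), (v, f v)) M vs = 0" using ann by metis
    then show "Y (v # vs) = cup1 (g v) X vs - cup1 (f v) Y vs"
      "X (v # vs) = - cup1 (g v) Y vs - cup1 (f v) X vs"
      unfolding cspin_def X_def[symmetric] Y_def[symmetric]
      by (simp_all add: complex_eq_iff spin_def contract_def zero)
  qed
  have "X vs = 0 \<and> Y vs = 0" if "odd (length vs)" for vs
    using that
  proof (induction vs rule: length_induct)
    case (1 vs)
    then obtain v ws where vs: "vs = v # ws" "even (length ws)" by (cases vs) auto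
    have "X (take i ws @ drop (Suc i) ws) = 0 \<and> Y (take i ws @ drop (Suc i) ws) = 0"
      if "i < length ws" for i
      using 1 vs that by auto
    then show ?case by (simp add: vs(1) rec cup1_def)
  qed
  then show ?thesis
    by (auto simp: has_parity_def X_def Y_def complex_eq_iff)
qed

text \<open>
  This carries the proof. In it, \<open>C p\<close> is \<open>a p - i a (J p)\<close> and \<open>D p\<close> is its conjugate: the \<open>C p\<close> are
  pairwise orthogonal and pair perfectly with the \<open>D p\<close>. The product \<open>W\<close> of the
  \<open>C (0, x e)\<close> applied to \<open>t\<close> is annihilated by every \<open>C p\<close>, hence is even by the graph condition;
  but it has the parity of \<open>n + (n + 1)\<close>. So \<open>W = 0\<close>, and the \<open>D (e, 0)\<close> strip off the factors to
  give \<open>t = 0\<close>.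
\<close>

lemma pure_spinor_parity:
  fixes A :: "'a::real_vector torus" and a :: "'a \<times> 'a dual \<Rightarrow> 'b::real_vector \<times> 'b dual"
  assumes A: "complex_torus A" and lin: "linear a"
    and iso: "\<And>p q. Qform (a p) (a q) = Qform p q"
    and graph: "\<And>v. \<exists>p. a p = (0, g v) \<and> a (J_prod A p) = (- v, - f v)"
    and t: "alt_form t" "\<And>v. spin (a (v, 0)) t = (\<lambda>_. 0)" "has_parity (Suc (torus_dim A)) t"
  shows "t = (\<lambda>_. 0)"
proof -
  note J = J_prod_props[OF A]
  have JA: "linear (cstr A)" "\<And>v. cstr A (cstr A v) = - v"
    using A by (simp_all add: complex_torus_def)
  obtain B where B: "finite_basis (B :: 'a set)"
    using lattice_basis[OF A] by metis
  obtain E x where E: "finite E" "2 * card E = dim (UNIV :: 'a set)"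
    and x: "\<forall>e\<in>E. \<forall>e'\<in>E. dual_app (x e) e' = (if e = e' then 1 else 0)"
      "\<forall>e\<in>E. \<forall>e'\<in>E. dual_app (x e) (cstr A e') = 0"
      "\<forall>v. v = (\<Sum>e\<in>E. dual_app (x e) v *\<^sub>R e - dual_app (x e) (cstr A v) *\<^sub>R cstr A e)"
    by (rule complex_dual_basis[OF B JA])
  have "dim (lat A) = dim (UNIV :: 'a set)"
    using span_lat[OF A] by (metis dim_span)
  then have n: "torus_dim A = card E"
    using E(2) by (simp add: torus_dim_def)
  obtain es where es: "set es = E" "distinct es"
    using finite_distinct_list[OF E(1)] by blast

  define C where "C p = (a p, - a (J_prod A p))" for p
  define D where "D p = (a p, a (J_prod A p))" for p
  define xs where "xs = map (\<lambda>e. C (0, x e))"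
  define T where "T = (\<lambda>vs. complex_of_real (t vs))"
  define W where "W = cspins (xs es) T"
  have T: "calt_form T"
    using t(1) zero_coh[of A] by (simp add: calt_form_def T_def alt_form_def linear_iff)
  have W: "calt_form W" unfolding W_def by (rule calt_form_cspins[OF T])

  have Q_neg: "Qform p (- q) = - Qform p q" "Qform (- p) q = - Qform p q" for p q :: "'c::real_vector \<times> 'c dual"
    by (simp_all add: Qform_def dual_app_simps linear_neg[OF linear_dual_app])
  have JQ: "Qform p (J_prod A q) = - Qform (J_prod A p) q" for p q
    using J(3)[of p "J_prod A q"] by (simp add: J(2) Q_neg)
  have CC: "cQform (C p) (C q) = 0" for p q
    by (simp add: C_def cQform_def iso Q_neg J(2) JQ complex_eq_iff)
  have DC: "cQform (D p) (C q) = Complex (2 * Qform p q) (2 * Qform (J_prod A p) q)" for p q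
    by (simp add: C_def D_def cQform_def iso Q_neg J(2) JQ complex_eq_iff)
  have Jv: "J_prod A (v, 0) = (cstr A v, 0)" for v
    using dual_app_cstr_dual[OF A, of 0]
    by (auto simp: J_prod_def dual_app_simps intro!: dual_eqI)
  have aneg: "a (- p) = - a p" for p
    using lin by (simp add: linear_neg)
  have ann_T: "cspin (C (v, 0)) T = (\<lambda>_. 0)" "cspin (D (v, 0)) T = (\<lambda>_. 0)" for v
  proof -
    have "- a (cstr A v, 0) = a (- cstr A v, 0)" using aneg[of "(cstr A v, 0)"] by simp
    then show "cspin (C (v, 0)) T = (\<lambda>_. 0)" "cspin (D (v, 0)) T = (\<lambda>_. 0)"
      using t(2) by (simp_all add: C_def D_def T_def cspin_def Jv spin_zero complex_eq_iff fun_eq_iff)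
  qed

  have CW: "cspin (C p) W = (\<lambda>_. 0)" for p
  proof -
    define K where "K = {p. cspin (C p) W = (\<lambda>_. 0)}"
    have "linear (\<lambda>p. cspin (C p) W vs)" for vs
    proof -
      have L: "linear (\<lambda>p. spin (a p) m vs)" "linear (\<lambda>p. spin (- a (J_prod A p)) m vs)"
        if "alt_form m" for m
        using linear_compose[OF lin linear_spin[OF that, of vs]]
          linear_compose[OF linear_compose_neg[OF linear_compose[OF J(1) lin]] linear_spin[OF that, of vs]]
        by (simp_all add: o_def)
      have "linear (\<lambda>p. Complex (h p) (k p))" if "linear h" "linear k" for h k :: "'a \<times> 'a dual \<Rightarrow> real"
        using that by (intro linearI) (simp_all add: linear_add linear_scale complex_eq_iff)
      then show ?thesis
        unfolding cspin_def C_def fst_conv snd_conv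
        using W L by (simp add: calt_form_def linear_compose_sub linear_compose_add)
    qed
    then have "subspace (\<Inter>vs. {p. cspin (C p) W vs = 0})"
      by (intro subspace_Int linear_subspace_kernel)
    also have "(\<Inter>vs. {p. cspin (C p) W vs = 0}) = K"
      by (auto simp: K_def fun_eq_iff)
    finally have K: "subspace K" .
    have K1: "(v, 0) \<in> K" for v
      unfolding K_def W_def using ann_T(1) T by (auto intro!: cspins_annihilated simp: xs_def CC)
    have K2: "(0, x e) \<in> K" if "e \<in> E" for e
      unfolding K_def W_def using T that es(1)
      by (auto intro!: cspins_member simp: xs_def CC)
    \<comment> \<open>\<open>C (J p)\<close> is \<open>i\<close> times \<open>C p\<close>.\<close>
    have K3: "J_prod A p \<in> K" if "p \<in> K" for p
    proof -
      have "cspin (C (J_prod A p)) W vs = \<i> * cspin (C p) W vs" for vs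
      proof -
        have "spin (- q) (\<lambda>vs. Re (W vs)) vs = - spin q (\<lambda>vs. Re (W vs)) vs"
          "spin (- q) (\<lambda>vs. Im (W vs)) vs = - spin q (\<lambda>vs. Im (W vs)) vs" for q
          using W by (simp_all add: calt_form_def linear_neg[OF linear_spin])
        then show ?thesis
          by (simp add: C_def J(2) aneg cspin_def complex_eq_iff)
      qed
      then show ?thesis using that by (simp add: K_def fun_eq_iff)
    qed
    obtain v y where p: "p = (v, y)" by (cases p)
    \<comment> \<open>The covectors \<open>x e\<close> and their images under the dual complex structure
      span the dual space, so \<open>K\<close> contains everything.\<close>
    have "y = (\<Sum>e\<in>E. dual_app y e *\<^sub>R x e + dual_app y (cstr A e) *\<^sub>R cstr (dual_torus A) (x e))"
    proof (rule dual_eqI)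
      fix u
      have "dual_app y u = dual_app y (\<Sum>e\<in>E. dual_app (x e) u *\<^sub>R e - dual_app (x e) (cstr A u) *\<^sub>R cstr A e)"
        using x(3) by metis
      also have "\<dots> = (\<Sum>e\<in>E. dual_app (x e) u * dual_app y e - dual_app (x e) (cstr A u) * dual_app y (cstr A e))"
        using linear_dual_app[of y] by (simp add: linear_sum linear_scale linear_diff)
      finally show "dual_app y u = dual_app (\<Sum>e\<in>E. dual_app y e *\<^sub>R x e
          + dual_app y (cstr A e) *\<^sub>R cstr (dual_torus A) (x e)) u"
        by (simp add: dual_app_sum dual_app_simps dual_app_cstr_dual[OF A] mult.commute)
    qed
    moreover have "J_prod A (0, x e) = (0, cstr (dual_torus A) (x e))" for e
      using JA(1) by (simp add: J_prod_def linear_0)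
    ultimately have "p = (v, 0) + (\<Sum>e\<in>E. dual_app y e *\<^sub>R (0, x e)
        + dual_app y (cstr A e) *\<^sub>R J_prod A (0, x e))"
      by (simp add: p prod_eq_iff fst_sum snd_sum)
    also have "\<dots> \<in> K"
      by (intro subspace_add[OF K] subspace_sum[OF K] subspace_scale[OF K] K1 K2 K3)
    finally show ?thesis by (simp add: K_def)
  qed

  have "cspin ((0, g v), (v, f v)) W = (\<lambda>_. 0)" for v
  proof -
    obtain p where "a p = (0, g v)" "a (J_prod A p) = (- v, - f v)" using graph by blast
    then show ?thesis using CW[of p] by (simp add: C_def)
  qed
  then have "has_parity 0 W" by (rule even_if_annihilated_by_graph[OF W])
  moreover have "has_parity (Suc 0) W"
  proof -
    have "length (xs es) = torus_dim A"
      using es n by (simp add: xs_def distinct_card[symmetric])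
    moreover have "has_parity (Suc (torus_dim A)) T"
      using t(3) by (simp add: has_parity_def T_def)
    ultimately have "has_parity (torus_dim A + Suc (torus_dim A)) W"
      unfolding W_def by (metis has_parity_cspins)
    then show ?thesis by (simp add: has_parity_def)
  qed
  ultimately have W0: "W = (\<lambda>_. 0)" by (rule has_parity_both)

  \<comment> \<open>Induction over the list of factors: \<open>D (e, 0)\<close> is orthogonal to all
    but the factor \<open>C (0, x e)\<close>, with which it pairs to \<open>2\<close>.\<close>
  have "T = (\<lambda>_. 0)" if "cspins (xs fs) T = (\<lambda>_. 0)" "set fs \<subseteq> E" "distinct fs" for fs
    using that
  proof (induction fs)
    case Nil
    then show ?case by (simp add: cspins_def xs_def)
  next
    case (Cons e fs)
    let ?M = "cspins (xs fs) T"
    have "cQform (D (e, 0)) (C (0, x e')) = (if e = e' then 2 else 0)" if "e' \<in> E" for e'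
      using x(1,2) that Cons.prems(2) by (simp add: DC Jv Qform_def dual_app_simps complex_eq_iff)
    moreover from this have "cspin (D (e, 0)) ?M = (\<lambda>_. 0)"
      using Cons.prems by (intro cspins_annihilated[OF T ann_T(2)]) (auto simp: xs_def)
    moreover have "cspin (C (0, x e)) ?M = (\<lambda>_. 0)"
      using Cons.prems(1) by (simp add: cspins_def xs_def)
    ultimately have "2 * ?M vs = 0" for vs
      using cspin_anticommutator[OF calt_form_cspins[OF T], of "D (e, 0)" "C (0, x e)" "xs fs" vs] Cons.prems(2)
      by (simp add: cspin_zero)
    then have "?M = (\<lambda>_. 0)" by auto
    then show ?case using Cons by simp
  qed
  from this[of es] W0 es have "T = (\<lambda>_. 0)" by (simp add: W_def)
  then show ?thesis by (simp add: T_def fun_eq_iff)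
qed

section \<open>From degree zero to all degrees\<close>

text \<open>
  The number operator \<open>\<Sum>\<^sub>b x\<^sub>b \<and> \<iota>\<^sub>b\<close> multiplies a form by its degree. In the induction, splitting off
  the first argument \<open>v\<close> contributes one copy of \<open>m\<close> and the number operator of the contraction of
  \<open>m\<close> with \<open>v\<close>.
\<close>

lemma euler_identity:
  assumes "finite B" "\<forall>v. v = (\<Sum>b\<in>B. dual_app (x b) v *\<^sub>R b)" "alt_form m"
  shows "(\<Sum>b\<in>B. cup1 (x b) (contract b m) vs) = real (length vs) * m vs"
  using assms(3)
proof (induction vs arbitrary: m)
  case Nil
  show ?case by (simp add: cup1_Nil)
next
  case (Cons v vs)
  have lin: "linear (\<lambda>u. m (u # vs))"
    using alt_form_linear[OF Cons.prems, of "[]" vs] by simp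
  have "m (v # vs) = m ((\<Sum>b\<in>B. dual_app (x b) v *\<^sub>R b) # vs)"
    using assms(2) by metis
  also have "\<dots> = (\<Sum>b\<in>B. dual_app (x b) v * contract b m vs)"
    by (simp add: linear_sum[OF lin] linear_scale[OF lin] contract_def)
  finally have 1: "(\<Sum>b\<in>B. dual_app (x b) v * contract b m vs) = m (v # vs)" by simp
  have "contract v (contract b m) = (\<lambda>vs. - 1 * contract b (contract v m) vs + 0 * m vs)" for b
    by (rule ext) (simp add: contract_anti[OF Cons.prems, of v b])
  then have "cup1 (x b) (contract v (contract b m)) vs = - cup1 (x b) (contract b (contract v m)) vs" for b
    by (simp only: cup1_lin)
  then have "(\<Sum>b\<in>B. cup1 (x b) (contract b m) (v # vs))
      = m (v # vs) + (\<Sum>b\<in>B. cup1 (x b) (contract b (contract v m)) vs)"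
    by (simp add: cup1_Cons sum.distrib 1)
  also have "\<dots> = m (v # vs) + real (length vs) * m (v # vs)"
    using Cons.IH[OF alt_form_contract[OF Cons.prems, of v]] by (simp add: contract_def[of v m vs])
  finally show ?case by (simp add: algebra_simps)
qed

text \<open>
  Expanding each argument in the basis leaves lists of more than \<open>card B\<close> basis vectors, which
  have repetitions. The list \<open>us\<close> collects the arguments already expanded.
\<close>

lemma alt_form_bounded_degree:
  fixes B :: "'a::real_vector set"
  assumes B: "finite_basis B" and m: "alt_form m" and "card B < length (vs :: 'a list)"
  shows "m vs = 0"
proof -
  have "m (us @ vs) = 0" if "set us \<subseteq> B" "card B < length us + length vs" for us
    using that
  proof (induction vs arbitrary: us)
    case Nil
    have "\<not> distinct us"
    proof
      assume "distinct us"
      then have "length us \<le> card B"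
        using Nil(1) B by (simp add: finite_basis_def distinct_card[symmetric] card_mono)
      then show False using Nil by simp
    qed
    then show ?case by (simp add: alt_form_rep[OF m])
  next
    case (Cons v vs)
    have "m (us @ v # vs) = (0::real)"
    proof (rule linear_eq_on[of "\<lambda>v. m (us @ v # vs)" "\<lambda>_. 0" v B])
      show "m (us @ b # vs) = 0" if "b \<in> B" for b
        using Cons.IH[of "us @ [b]"] Cons.prems that by simp
    qed (use B alt_form_linear[OF m] in \<open>simp_all add: finite_basis_def linear_iff\<close>)
    then show ?case .
  qed
  from this[of "[]"] assms(3) show ?thesis by simp
qed

lemma clifford_module_iso_spin:
  assumes A: "complex_torus A" and B: "complex_torus B" and \<alpha>: "bij_betw \<alpha> (Lam A) (Lam B)"
    and \<beta>: "clifford_module_iso A B \<alpha> \<beta>" and p: "p \<in> Lam A" and m: "m \<in> coh A"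
  shows "\<beta> (spin p m) = spin (\<alpha> p) (\<beta> m)"
proof -
  obtain \<theta> where \<theta>: "\<forall>p\<in>Lam A. \<theta> (clifford_gen (Lam A) Qform p) = clifford_gen (Lam B) Qform (\<alpha> p)"
    "\<forall>c\<in>carrier (clifford_ring (Lam A) Qform). \<forall>m\<in>coh A.
       \<beta> (clifford_act c m) = clifford_act (\<theta> c) (\<beta> m)"
    using \<beta> by (auto simp: clifford_module_iso_def)
  have \<beta>m: "\<beta> m \<in> coh B" and \<alpha>p: "\<alpha> p \<in> Lam B"
    using \<beta> m \<alpha> p by (auto simp: clifford_module_iso_def bij_betw_def)
  have "word [p] \<in> carrier (free_ring (Lam A))"
    using p by (intro word_carrier) simp
  then have "clifford_gen (Lam A) Qform p \<in> carrier (clifford_ring (Lam A) Qform)"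
    by (auto simp: clifford_ring_def clifford_class_def FactRing_def A_RCOSETS_def' )
  then have "\<beta> (clifford_act (clifford_gen (Lam A) Qform p) m)
      = clifford_act (clifford_gen (Lam B) Qform (\<alpha> p)) (\<beta> m)"
    using \<theta> p m by simp
  then show ?thesis
    by (simp add: clifford_act_gen[OF A p m] clifford_act_gen[OF B \<alpha>p \<beta>m])
qed

lemma additive_on_coh:
  assumes add: "\<forall>m\<in>coh A. \<forall>m'\<in>coh A. \<beta> (\<lambda>vs. m vs + m' vs) = (\<lambda>vs. \<beta> m vs + \<beta> m' vs)"
  shows "\<beta> (\<lambda>_. 0) = (\<lambda>_. 0 :: real)"
    and "m \<in> coh A \<Longrightarrow> \<beta> (\<lambda>vs. real k * m vs) = (\<lambda>vs. real k * \<beta> m vs)"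
    and "finite S \<Longrightarrow> (\<And>b. b \<in> S \<Longrightarrow> F b \<in> coh A) \<Longrightarrow>
      (\<lambda>vs. \<Sum>b\<in>S. F b vs) \<in> coh A \<and> \<beta> (\<lambda>vs. \<Sum>b\<in>S. F b vs) = (\<lambda>vs. \<Sum>b\<in>S. \<beta> (F b) vs)"
proof -
  have "\<beta> (\<lambda>_. 0) = (\<lambda>vs. \<beta> (\<lambda>_. 0) vs + \<beta> (\<lambda>_. 0) vs)"
    using bspec[OF bspec[OF add zero_coh] zero_coh] by simp
  then show zero: "\<beta> (\<lambda>_. 0) = (\<lambda>_. 0 :: real)"
    by (simp add: fun_eq_iff)
  show "\<beta> (\<lambda>vs. real k * m vs) = (\<lambda>vs. real k * \<beta> m vs)" if m: "m \<in> coh A"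
  proof (induction k)
    case (Suc k)
    have k: "(\<lambda>vs. real k * m vs) \<in> coh A"
      using coh_lin[OF m m, of "real k" 0] by simp
    have "\<beta> (\<lambda>vs. real k * m vs + m vs) = (\<lambda>vs. real k * \<beta> m vs + \<beta> m vs)"
      using bspec[OF bspec[OF add k] m] by (simp add: Suc.IH)
    then show ?case by (simp add: algebra_simps)
  qed (simp add: zero)
  show "(\<lambda>vs. \<Sum>b\<in>S. F b vs) \<in> coh A \<and> \<beta> (\<lambda>vs. \<Sum>b\<in>S. F b vs) = (\<lambda>vs. \<Sum>b\<in>S. \<beta> (F b) vs)"
    if "finite S" "\<And>b. b \<in> S \<Longrightarrow> F b \<in> coh A"
    using that
  proof (induction S)
    case empty
    then show ?case by (simp add: zero zero_coh)
  next
    case (insert b S)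
    have 1: "F b \<in> coh A" "(\<lambda>vs. \<Sum>b\<in>S. F b vs) \<in> coh A"
      using insert by auto
    have 2: "\<beta> (\<lambda>vs. F b vs + (\<Sum>b\<in>S. F b vs)) = (\<lambda>vs. \<beta> (F b) vs + (\<Sum>b\<in>S. \<beta> (F b) vs))"
      using bspec[OF bspec[OF add 1(1)] 1(2)] insert by simp
    have 3: "(\<lambda>vs. F b vs + (\<Sum>b\<in>S. F b vs)) \<in> coh A"
      using coh_lin[OF 1, of 1 1] by simp
    show ?case using 2 3 insert(1,2) by simp
  qed
qed

definition coh_of_parity :: "'a::real_vector torus \<Rightarrow> nat \<Rightarrow> ('a list \<Rightarrow> real) set" where
  "coh_of_parity A k = {m \<in> coh A. has_parity k m}"

lemma coh_ev_eq: "coh_ev A = coh_of_parity A 0"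
  and coh_odd_eq: "coh_odd A = coh_of_parity A 1"
  by (auto simp: coh_ev_def coh_odd_def coh_of_parity_def has_parity_def)

text \<open>
  Induction on a bound for the degrees occurring in \<open>m\<close>. Of degree less than \<open>k + 1\<close>, the form \<open>m\<close> satisfies
  \<open>k m = N m + (k - N) m\<close> for the number operator \<open>N\<close>. The contractions that enter \<open>N m\<close> and the form
  \<open>(k - N) m\<close>, in which the component of degree \<open>k\<close> has been cancelled, have degrees less than
  \<open>k\<close>. The factor \<open>k\<close> is divided out after applying \<open>\<beta>\<close>, since only integral forms lie in the
  domain.
\<close>

lemma parity_of_spinor_iso:
  assumes A: "complex_torus A"
    and add: "\<forall>m\<in>coh A. \<forall>m'\<in>coh A. \<beta> (\<lambda>vs. m vs + m' vs) = (\<lambda>vs. \<beta> m vs + \<beta> m' vs)"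
    and spin: "\<And>p m. p \<in> Lam A \<Longrightarrow> m \<in> coh A \<Longrightarrow> \<beta> (spin p m) = spin (a p) (\<beta> m)"
    and base: "\<And>m. m \<in> coh A \<Longrightarrow> (\<And>l. contract l m = (\<lambda>_. 0)) \<Longrightarrow> has_parity n (\<beta> m)"
    and m: "m \<in> coh_of_parity A j"
  shows "has_parity (j + n) (\<beta> m)"
proof -
  obtain B x where B: "finite_basis B" and L': "\<forall>b\<in>B. (b, 0) \<in> Lam A \<and> (0, x b) \<in> Lam A"
    and ex: "\<forall>v. v = (\<Sum>b\<in>B. dual_app (x b) v *\<^sub>R b)"
    by (rule lattice_basis[OF A])
  then have L: "(b, 0) \<in> Lam A" "(0, x b) \<in> Lam A" if "b \<in> B" for b
    using that by auto
  have finB: "finite B" using B by (simp add: finite_basis_def)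
  note \<beta> = additive_on_coh[OF add]
  have spin_vec: "spin (b, 0) m = contract b m" for b m
    by (rule ext) (simp add: spin_def cup1_def dual_app_simps)
  have "has_parity (j + n) (\<beta> m)"
    if "m \<in> coh A" "has_parity j m" "\<And>vs. k \<le> length vs \<Longrightarrow> m vs = 0" for k j m
    using that
  proof (induction k arbitrary: j m)
    case 0
    then have "m = (\<lambda>_. 0)" by auto
    then show ?case by (simp add: \<beta>(1) has_parity_def)
  next
    case (Suc k)
    have alt: "alt_form m" using Suc.prems(1) by (simp add: coh_def)
    show ?case
    proof (cases "k = 0")
      case True
      show ?thesis
      proof (cases "even j")
        case True
        have "has_parity n (\<beta> m)"
          using Suc.prems \<open>k = 0\<close> by (intro base) (auto simp: contract_def)
        then show ?thesis using True by (subst has_parity_cong[of _ n]) auto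
      next
        case False
        have "m vs = 0" for vs
          using Suc.prems(2,3) False \<open>k = 0\<close> by (cases vs) (auto simp: has_parity_def)
        then have "m = (\<lambda>_. 0)" by auto
        then show ?thesis by (simp add: \<beta>(1) has_parity_def)
      qed
    next
      case False
      define F where "F b = spin (0, x b) (spin (b, 0) m)" for b
      define E where "E = (\<lambda>vs. \<Sum>b\<in>B. F b vs)"
      define R where "R = (\<lambda>vs. real k * m vs - E vs)"
      have mb: "spin (b, 0) m \<in> coh A" if "b \<in> B" for b
        by (rule spin_coh[OF L(1)[OF that] Suc.prems(1)])
      have F: "F b \<in> coh A" if "b \<in> B" for b
        unfolding F_def by (rule spin_coh[OF L(2)[OF that] mb[OF that]])
      have E: "E vs = real (length vs) * m vs" for vs
      proof -
        have "F b vs = cup1 (x b) (contract b m) vs" for b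
          using linear_0[OF alt_form_linear[OF alt_form_contract[OF alt, of b], of "[]" vs]]
          by (simp add: F_def spin_vec spin_def contract_def[of 0])
        then show ?thesis
          unfolding E_def using euler_identity[OF finB ex alt, of vs] by simp
      qed
      have E_coh: "E \<in> coh A" and \<beta>E: "\<beta> E = (\<lambda>vs. \<Sum>b\<in>B. \<beta> (F b) vs)"
        using \<beta>(3)[OF finB, of F] F unfolding E_def by auto
      have R_coh: "R \<in> coh A"
        using coh_lin[OF Suc.prems(1) E_coh, of "real k" "-1"] by (simp add: R_def)
      have "has_parity (j + n) (\<beta> (F b))" if b: "b \<in> B" for b
      proof -
        have "spin (b, 0) m vs = 0" if "k \<le> length vs" for vs
          using that Suc.prems(3)[of "b # vs"] unfolding spin_vec by (simp add: contract_def)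
        then have "has_parity (Suc j + n) (\<beta> (spin (b, 0) m))"
          by (rule Suc.IH[OF mb[OF b] has_parity_spin[OF Suc.prems(2)]])
        from has_parity_spin[OF this] show ?thesis
          unfolding F_def spin[OF L(2)[OF b] mb[OF b]]
          by (subst has_parity_cong[of _ "Suc (Suc j + n)"]) auto
      qed
      then have 1: "has_parity (j + n) (\<beta> E)"
        by (simp add: \<beta>E has_parity_def)
      have 2: "has_parity (j + n) (\<beta> R)"
      proof (rule Suc.IH[OF R_coh])
        show "has_parity j R" using Suc.prems(2) by (simp add: has_parity_def R_def E)
        show "R vs = 0" if "k \<le> length vs" for vs
          using that Suc.prems(3)[of vs] by (cases "length vs = k") (auto simp: R_def E)
      qed
      have "\<beta> (\<lambda>vs. real k * m vs) = (\<lambda>vs. \<beta> E vs + \<beta> R vs)"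
        using bspec[OF bspec[OF add E_coh] R_coh] by (simp add: R_def)
      then have "real k * \<beta> m vs = \<beta> E vs + \<beta> R vs" for vs
        by (simp add: \<beta>(2)[OF Suc.prems(1)] fun_eq_iff)
      moreover have "\<beta> E vs + \<beta> R vs = 0" if "odd (length vs + (j + n))" for vs
        using 1 2 that by (simp add: has_parity_def)
      ultimately show ?thesis
        using False unfolding has_parity_def by (metis mult_eq_0_iff of_nat_eq_0_iff)
    qed
  qed
  from this[of m j "Suc (card B)"] m show ?thesis
    using alt_form_bounded_degree[OF B] by (auto simp: coh_of_parity_def coh_def)
qed

section \<open>The parity of the module isomorphism\<close>

text \<open>
  The unit class of \<open>H\<^sup>0\<close>; being nonzero and even, it prevents \<open>\<beta>\<close> from being both even and odd.
\<close>

definition vacuum :: "'v list \<Rightarrow> real" where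
  "vacuum vs = (if vs = [] then 1 else 0)"

lemma vacuum_coh: "vacuum \<in> coh A"
  by (auto simp: coh_def alt_form_def vacuum_def linear_iff)

text \<open>
  A preimage of a form of given parity can be replaced by its component of the matching parity: the
  other component is mapped to a form of both parities, that is, to zero.
\<close>

lemma parity_of_graded_iso:
  assumes bij: "bij_betw \<beta> (coh A) (coh B)"
    and add: "\<forall>m\<in>coh A. \<forall>m'\<in>coh A. \<beta> (\<lambda>vs. m vs + m' vs) = (\<lambda>vs. \<beta> m vs + \<beta> m' vs)"
    and par: "\<And>j m. m \<in> coh_of_parity A j \<Longrightarrow> has_parity (j + n) (\<beta> m)"
  shows "(even_iso A B \<beta> \<longleftrightarrow> even n) \<and> (odd_iso A B \<beta> \<longleftrightarrow> odd n)"
proof -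
  have zero: "\<beta> (\<lambda>_. 0) = (\<lambda>_. 0)" by (rule additive_on_coh(1)[OF add])
  have img: "\<beta> ` coh_of_parity A j = coh_of_parity B (j + n)" for j
  proof (intro equalityI subsetI)
    fix m' assume "m' \<in> \<beta> ` coh_of_parity A j"
    then show "m' \<in> coh_of_parity B (j + n)"
      using par bij by (auto simp: coh_of_parity_def bij_betw_def)
  next
    fix m' assume m': "m' \<in> coh_of_parity B (j + n)"
    then have "m' \<in> \<beta> ` coh A" using bij by (simp add: coh_of_parity_def bij_betw_def)
    then obtain m where m: "m \<in> coh A" "m' = \<beta> m" by blast
    let ?p = "parity_part j m" and ?q = "parity_part (Suc j) m"
    have pq: "?p \<in> coh_of_parity A j" "?q \<in> coh_of_parity A (Suc j)"
      using m(1) by (simp_all add: coh_of_parity_def parity_part_coh has_parity_parity_part)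
    have "(\<lambda>vs. ?p vs + ?q vs) = m"
      by (auto simp: parity_part_def)
    then have sum: "m' vs = \<beta> ?p vs + \<beta> ?q vs" for vs
      using bspec[OF bspec[OF add parity_part_coh[OF m(1)]] parity_part_coh[OF m(1)], of j "Suc j"]
      by (simp add: m(2))
    have "has_parity (j + n) (\<beta> ?q)"
      using sum m' par[OF pq(1)] by (auto simp: coh_of_parity_def has_parity_def)
    then have "\<beta> ?q = (\<lambda>_. 0)"
      using has_parity_both[of "j + n" "\<beta> ?q"] par[OF pq(2)] by simp
    then have "m' = \<beta> ?p" using sum by auto
    then show "m' \<in> \<beta> ` coh_of_parity A j" using pq(1) by blast
  qed
  have cong: "coh_of_parity B k = coh_of_parity B l" if "even (k + l)" for k l
    using has_parity_cong[OF that] by (auto simp: coh_of_parity_def)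
  have "\<not> (even_iso A B \<beta> \<and> odd_iso A B \<beta>)"
  proof
    assume "even_iso A B \<beta> \<and> odd_iso A B \<beta>"
    moreover have "vacuum \<in> coh_ev A"
      using vacuum_coh[of A] by (auto simp: coh_ev_def vacuum_def)
    ultimately have "\<beta> vacuum \<in> coh_ev B" "\<beta> vacuum \<in> coh_odd B"
      by (auto simp: even_iso_def odd_iso_def)
    then have "\<beta> vacuum = (\<lambda>_. 0)"
      using has_parity_both[of 0 "\<beta> vacuum"]
      by (simp add: coh_ev_eq coh_odd_eq coh_of_parity_def)
    then have "(vacuum :: 'a list \<Rightarrow> real) = (\<lambda>_. 0)"
      using inj_onD[OF bij_betw_imp_inj_on[OF bij], of vacuum "\<lambda>_. 0"]
      by (simp add: zero vacuum_coh zero_coh)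
    from fun_cong[OF this, of "[]"] show False by (simp add: vacuum_def)
  qed
  moreover have "even_iso A B \<beta>" if "even n"
    using that img[of 0] img[of 1] cong[of n 0] cong[of "1 + n" 1]
    by (simp add: even_iso_def coh_ev_eq coh_odd_eq)
  moreover have "odd_iso A B \<beta>" if "odd n"
    using that img[of 0] img[of 1] cong[of n 1] cong[of "1 + n" 0]
    by (simp add: odd_iso_def coh_ev_eq coh_odd_eq)
  ultimately show ?thesis by blast
qed

theorem proposition9p3p2:
  fixes A :: "'a::real_vector torus" and B :: "'b::real_vector torus"
    and \<omega>A :: "'a \<Rightarrow> 'a \<Rightarrow> complex" and \<omega>B :: "'b \<Rightarrow> 'b \<Rightarrow> complex"
    and \<alpha> :: "'a \<times> 'a dual \<Rightarrow> 'b \<times> 'b dual"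
    and \<beta> :: "('a list \<Rightarrow> real) \<Rightarrow> ('b list \<Rightarrow> real)"
    and n :: nat
  assumes "weak_pair A \<omega>A" and "weak_pair B \<omega>B"
    and "mirror_symmetry A \<omega>A B \<omega>B \<alpha>"
    and "torus_dim A = n" and "torus_dim B = n"
    and "clifford_module_iso A B \<alpha> \<beta>"
  shows "(even_iso A B \<beta> \<longleftrightarrow> even n) \<and> (odd_iso A B \<beta> \<longleftrightarrow> odd n)"
proof (rule parity_of_graded_iso)
  have A: "complex_torus A" and B: "complex_torus B"
    using assms(1,2) by (simp_all add: weak_pair_def)
  obtain a where \<alpha>: "lattice_isometry A B \<alpha>" and a: "linear a" "\<forall>p\<in>Lam A. a p = \<alpha> p"
    and aJ: "a \<circ> J_prod A = I_om \<omega>B \<circ> a"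
    using assms(3) by (auto simp: mirror_symmetry_def)
  note ext = lattice_isometry_extension[OF A B \<alpha> a]
  obtain f g where fg: "\<forall>v. I_om \<omega>B (0, g v) = (- v, - f v)"
    by (rule I_om_covector_graph[OF assms(2)])
  have graph: "\<exists>p. a p = (0, g v) \<and> a (J_prod A p) = (- v, - f v)" for v
  proof -
    obtain p where "a p = (0, g v)" using surjD[OF ext(1), of "(0, g v)"] by auto
    then show ?thesis using fun_cong[OF aJ, of p] fg by (intro exI[of _ p]) simp
  qed
  have coh: "\<beta> m \<in> coh B" if "m \<in> coh A" for m
    using assms(6) that by (auto simp: clifford_module_iso_def bij_betw_def)
  show bij: "bij_betw \<beta> (coh A) (coh B)"
    and add: "\<forall>m\<in>coh A. \<forall>m'\<in>coh A. \<beta> (\<lambda>vs. m vs + m' vs) = (\<lambda>vs. \<beta> m vs + \<beta> m' vs)"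
    using assms(6) by (simp_all add: clifford_module_iso_def)
  have spin: "\<beta> (spin p m) = spin (a p) (\<beta> m)" if "p \<in> Lam A" "m \<in> coh A" for p m
    using clifford_module_iso_spin[OF A B _ assms(6) that] \<alpha> a(2) that(1)
    by (simp add: lattice_isometry_def)
  have base: "has_parity n (\<beta> m)" if m: "m \<in> coh A" "\<And>l. contract l m = (\<lambda>_. 0)" for m
  proof -
    have alt: "alt_form (\<beta> m)" using coh[OF m(1)] by (simp add: coh_def)
    have ann: "spin (a (v, 0)) (\<beta> m) = (\<lambda>_. 0)" for v
    proof
      fix vs
      show "spin (a (v, 0)) (\<beta> m) vs = 0"
      proof (rule linear_eq_on[of "\<lambda>v. spin (a (v, 0)) (\<beta> m) vs" "\<lambda>_. 0" v "lat A"])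
        have "linear (\<lambda>v :: 'a. (v, 0 :: 'a dual))" by (simp add: linear_iff)
        from linear_compose[OF linear_compose[OF this a(1)] linear_spin[OF alt, of vs]]
        show "linear (\<lambda>v. spin (a (v, 0)) (\<beta> m) vs)" by (simp add: o_def)
        show "v \<in> span (lat A)" by (simp add: span_lat[OF A])
        fix l assume "l \<in> lat A"
        then have "(l, 0) \<in> Lam A"
          by (simp add: Lam_def dual_torus_def dual_app_simps)
        moreover have "spin (l, 0) m = (\<lambda>_. 0)"
          using m(2)[of l] by (simp add: fun_eq_iff spin_def cup1_def dual_app_simps)
        ultimately have "spin (a (l, 0)) (\<beta> m) = (\<lambda>_. 0)"
          using spin[of "(l, 0)" m, symmetric] m(1) by (simp add: additive_on_coh(1)[OF add])
        then show "spin (a (l, 0)) (\<beta> m) vs = 0" by simp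
      qed (simp add: linear_iff)
    qed
    \<comment> \<open>The Clifford action is odd, so the component of the wrong parity is
      annihilated by the same vectors.\<close>
    have "parity_part (Suc n) (\<beta> m) = (\<lambda>_. 0)"
    proof (rule pure_spinor_parity[OF A a(1) ext(2) graph])
      show "alt_form (parity_part (Suc n) (\<beta> m))" by (rule alt_form_parity_part[OF alt])
      show "spin (a (v, 0)) (parity_part (Suc n) (\<beta> m)) = (\<lambda>_. 0)" for v
        by (simp add: spin_parity_part ann parity_part_def fun_eq_iff)
      show "has_parity (Suc (torus_dim A)) (parity_part (Suc n) (\<beta> m))"
        using has_parity_parity_part[of "Suc n"] assms(4) by simp
    qed
    then have "parity_part (Suc n) (\<beta> m) vs = 0" for vs by simp
    then have "\<beta> m vs = 0" if "odd (length vs + n)" for vs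
      using that unfolding parity_part_def by (metis add_Suc_right even_Suc)
    then show ?thesis by (simp add: has_parity_def)
  qed
  show "has_parity (j + n) (\<beta> m)" if "m \<in> coh_of_parity A j" for j m
    by (rule parity_of_spinor_iso[OF A add spin base that])
qed

end
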